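(* Suppose there exists an integer $d\ge 3$ such that for every integer $p\ge1$ there exists $k_0(d,p)$ such that for every $k\ge k_0(d,p)$ there exists a $p$-shuffle chain on $\mathcal{C}_k^{(d)}$ whose stationary distribution is the uniform distribution on $\mathcal{C}_k^{(d)}$. Then the Jacobian conjecture holds: for every $n\ge1$, every Keller map $F:\mathbb{C}^n\to\mathbb{C}^n$ is a polynomial automorphism.
   Context: For $d\ge2$, a $d$-Catalan tree is a rooted planar tree in which every vertex has $0$ or $d$ children (internal vertices have $d$); $\mathcal{C}_k^{(d)}$ is the set of such trees with $k$ internal vertices. The height of a vertex is its graph distance to the root. A path of length $p$ is $(v_0,\dots,v_p)$ with $v_i$ a child of $v_{i-1}$; every vertex $v$ of height $\ge p$ is the endpoint $v_p$ of a unique such path. For $1\le i\le p$ the $d-1$ siblings of $v_i$ subtend subtrees (sibling plus descendants); the shuffle class $\mathrm{Sh}_{T,p}(v)\subseteq\mathcal{C}_k^{(d)}$ is the set of trees obtained from $T$ by rearranging these $(d-1)p$ subtrees among the $(d-1)p$ sibling positions, all else fixed. A $p$-shuffle chain on $\mathcal{C}_k^{(d)}$ is specified by a family $\{P_T: T\in\mathcal{C}_k^{(d)}\}$ where $P_T$ is a probability measure on the vertex set $V(T)$ with $P_T(v)>0$ iff $v$ has height at least $p$; it is the Markov chain on $\mathcal{C}_k^{(d)}$ with transition probabilities $\mathbb{P}(T_{j+1}=T'\mid T_j=T)=\sum_{v\in V(T)}P_T(v)\,\mathbf{1}\{T'\in\mathrm{Sh}_{T,p}(v)\}/\#\mathrm{Sh}_{T,p}(v)$.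 A polynomial mapping $F:\mathbb{C}^n\to\mathbb{C}^n$ is a Keller map if $\det JF$ is a nonzero constant, and a polynomial automorphism if it has a polynomial two-sided compositional inverse. *)

theory Defs
  imports "HOL-Analysis.Analysis"
begin

datatype ptree = Node "ptree list"

fun children :: "ptree \<Rightarrow> ptree list" where
  "children (Node ts) = ts"

text \<open>Vertices are addressed by positions: the list of child indices from the root.
  The height of a vertex is the length of its position.\<close>

fun is_pos :: "ptree \<Rightarrow> nat list \<Rightarrow> bool" where
  "is_pos t [] = True"
| "is_pos t (i # is) = (i < length (children t) \<and> is_pos (children t ! i) is)"

definition vertices :: "ptree \<Rightarrow> nat list set" where
  "vertices t = {q. is_pos t q}"

fun subt :: "ptree \<Rightarrow> nat list \<Rightarrow> ptree" where
  "subt t [] = t"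
| "subt t (i # is) = subt (children t ! i) is"

fun replace :: "ptree \<Rightarrow> nat list \<Rightarrow> ptree \<Rightarrow> ptree" where
  "replace t [] u = u"
| "replace t (i # is) u = Node ((children t)[i := replace (children t ! i) is u])"

definition is_catalan :: "nat \<Rightarrow> ptree \<Rightarrow> bool" where
  "is_catalan d t \<longleftrightarrow>
     (\<forall>q \<in> vertices t. length (children (subt t q)) = 0 \<or> length (children (subt t q)) = d)"

definition internal_vertices :: "ptree \<Rightarrow> nat list set" where
  "internal_vertices t = {q \<in> vertices t. children (subt t q) \<noteq> []}"

definition catalan_trees :: "nat \<Rightarrow> nat \<Rightarrow> ptree set" where
  "catalan_trees d k = {t. is_catalan d t \<and> card (internal_vertices t) = k}"

text \<open>For a vertex \<open>v\<close> of height \<open>\<ge> p\<close>, the path of length \<open>p\<close> ending at \<open>v\<close> is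
  \<open>v_i = take (length v - p + i) v\<close>, \<open>0 \<le> i \<le> p\<close>.  The siblings of \<open>v_i\<close> (\<open>1 \<le> i \<le> p\<close>)
  are the positions \<open>take j v @ [c]\<close> with \<open>j = length v - p + i - 1\<close>, \<open>c < d\<close>, \<open>c \<noteq> v ! j\<close>.\<close>
definition sibling_positions :: "nat \<Rightarrow> nat \<Rightarrow> nat list \<Rightarrow> nat list set" where
  "sibling_positions d p v =
     {take j v @ [c] | j c. length v - p \<le> j \<and> j < length v \<and> c < d \<and> c \<noteq> v ! j}"

text \<open>Rearranging the subtrees subtended by the sibling positions \<open>S\<close> according to a
  permutation \<open>\<sigma>\<close> of \<open>S\<close>: the subtree of \<open>T\<close> at \<open>\<sigma> s\<close> is moved to position \<open>s\<close>.
  Since the positions in \<open>S\<close> are pairwise incomparable (no one is a prefix of another),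
  the order in which the replacements are carried out is irrelevant.\<close>
definition rearrange :: "ptree \<Rightarrow> nat list list \<Rightarrow> (nat list \<Rightarrow> nat list) \<Rightarrow> ptree" where
  "rearrange T xs \<sigma> = foldr (\<lambda>s t. replace t s (subt T (\<sigma> s))) xs T"

definition shuffle_class :: "nat \<Rightarrow> ptree \<Rightarrow> nat \<Rightarrow> nat list \<Rightarrow> ptree set" where
  "shuffle_class d T p v =
     {T'. \<exists>xs \<sigma>. distinct xs \<and> set xs = sibling_positions d p v \<and>
                 \<sigma> permutes sibling_positions d p v \<and> T' = rearrange T xs \<sigma>}"

definition is_shuffle_family :: "nat \<Rightarrow> nat \<Rightarrow> nat \<Rightarrow> (ptree \<Rightarrow> nat list \<Rightarrow> real) \<Rightarrow> bool" where
  "is_shuffle_family d p k P \<longleftrightarrow>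
     (\<forall>T \<in> catalan_trees d k.
        (\<forall>v \<in> vertices T. 0 \<le> P T v) \<and>
        (\<Sum>v \<in> vertices T. P T v) = 1 \<and>
        (\<forall>v \<in> vertices T. 0 < P T v \<longleftrightarrow> p \<le> length v))"

definition shuffle_trans :: "nat \<Rightarrow> nat \<Rightarrow> (ptree \<Rightarrow> nat list \<Rightarrow> real) \<Rightarrow> ptree \<Rightarrow> ptree \<Rightarrow> real" where
  "shuffle_trans d p P T T' =
     (\<Sum>v \<in> vertices T. P T v *
        (if T' \<in> shuffle_class d T p v then 1 / real (card (shuffle_class d T p v)) else 0))"

definition uniform_stationary :: "nat \<Rightarrow> nat \<Rightarrow> nat \<Rightarrow> (ptree \<Rightarrow> nat list \<Rightarrow> real) \<Rightarrow> bool" where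
  "uniform_stationary d p k P \<longleftrightarrow>
     (\<forall>T' \<in> catalan_trees d k.
        (\<Sum>T \<in> catalan_trees d k. (1 / real (card (catalan_trees d k))) * shuffle_trans d p P T T')
          = 1 / real (card (catalan_trees d k)))"

definition poly_fun :: "(complex ^ 'n \<Rightarrow> complex) \<Rightarrow> bool" where
  "poly_fun f \<longleftrightarrow>
     (\<exists>(S :: ('n \<Rightarrow> nat) set) (c :: ('n \<Rightarrow> nat) \<Rightarrow> complex). finite S \<and>
        (\<forall>x. f x = (\<Sum>m \<in> S. c m * (\<Prod>i \<in> UNIV. (x $ i) ^ m i))))"

definition poly_map :: "(complex ^ 'n \<Rightarrow> complex ^ 'n) \<Rightarrow> bool" where
  "poly_map F \<longleftrightarrow> (\<forall>i. poly_fun (\<lambda>x. F x $ i))"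

definition jacobian_matrix :: "(complex ^ 'n \<Rightarrow> complex ^ 'n) \<Rightarrow> complex ^ 'n \<Rightarrow> complex ^ 'n ^ 'n" where
  "jacobian_matrix F x =
     (\<chi> i j. deriv (\<lambda>t. F (\<chi> k. if k = j then t else x $ k) $ i) (x $ j))"

definition keller_map :: "(complex ^ 'n \<Rightarrow> complex ^ 'n) \<Rightarrow> bool" where
  "keller_map F \<longleftrightarrow> poly_map F \<and> (\<exists>c. c \<noteq> 0 \<and> (\<forall>x. det (jacobian_matrix F x) = c))"

definition poly_automorphism :: "(complex ^ 'n \<Rightarrow> complex ^ 'n) \<Rightarrow> bool" where
  "poly_automorphism F \<longleftrightarrow> poly_map F \<and> (\<exists>G. poly_map G \<and> G \<circ> F = id \<and> F \<circ> G = id)"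

end

theory Submission
  imports Defs "HOL-Library.Sublist" "HOL-Library.Function_Algebras"
    "HOL-Computational_Algebra.Fundamental_Theorem_Algebra"
begin

text \<open>
  By stable equivalence (Bass, Connell and Wright) it suffices to invert maps \<open>F = id - K\<close> whose
  perturbation \<open>K\<close> is homogeneous of degree \<open>d\<close>. Invertibility of the derivative everywhere then
  makes every \<open>JK(x)\<close> nilpotent, with a uniform exponent \<open>p\<close>. Let \<open>\<mu>\<close> be the symmetric multilinear
  form with diagonal \<open>K\<close>, and evaluate a \<open>d\<close>-Catalan tree at \<open>y\<close> by putting \<open>y\<close> at the leaves and
  \<open>\<mu>\<close> at the internal vertices; the formal inverse of \<open>F\<close> is the sum of the values of all trees.
  Polarising \<open>JK(x)^p = 0\<close> shows that the values of the trees of a \<open>p\<close>-shuffle class add up to zero.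
  If a \<open>p\<close>-shuffle chain on the trees with \<open>k\<close> internal vertices preserves the uniform
  distribution, then the constant function is a combination of indicators of shuffle classes, so the
  degree-\<open>k\<close> part of the inverse vanishes; as this holds for all large \<open>k\<close>, the inverse is polynomial.
\<close>

section \<open>Polarisation\<close>

definition multi_additive :: "'a set \<Rightarrow> (('a \<Rightarrow> 'v::ab_group_add) \<Rightarrow> 'w::ab_group_add) \<Rightarrow> bool" where
  "multi_additive S Q \<longleftrightarrow> (\<forall>z. \<forall>s\<in>S. Modules.additive (\<lambda>a. Q (z(s := a))))"

lemma multi_additive_expand:
  assumes Q: "multi_additive S Q" and "finite A" "A \<subseteq> S"
  shows "Q (override_on z (\<lambda>_. \<Sum>j\<in>B. w j) A) = (\<Sum>\<phi>\<in>A \<rightarrow>\<^sub>E B. Q (override_on z (w \<circ> \<phi>) A))"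
  using assms(2,3)
proof (induction A arbitrary: z rule: finite_induct)
  case empty
  then show ?case by simp
next
  case (insert s A)
  have "Q (override_on z (\<lambda>_. \<Sum>j\<in>B. w j) (insert s A))
      = Q ((override_on z (\<lambda>_. \<Sum>j\<in>B. w j) A)(s := \<Sum>j\<in>B. w j))"
    by (simp add: override_on_insert)
  also have "\<dots> = (\<Sum>j\<in>B. Q ((override_on z (\<lambda>_. \<Sum>j\<in>B. w j) A)(s := w j)))"
    using Q insert.prems unfolding multi_additive_def by (intro additive.sum) blast
  also have "\<dots> = (\<Sum>j\<in>B. Q (override_on (z(s := w j)) (\<lambda>_. \<Sum>j\<in>B. w j) A))"
    using insert.hyps by (intro sum.cong refl arg_cong[where f = Q]) (auto simp: override_on_def)
  also have "\<dots> = (\<Sum>j\<in>B. \<Sum>\<phi>\<in>A \<rightarrow>\<^sub>E B. Q (override_on (z(s := w j)) (w \<circ> \<phi>) A))"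
    using insert.IH insert.prems by (simp add: o_def)
  also have "\<dots> = (\<Sum>(j, \<phi>)\<in>B \<times> (A \<rightarrow>\<^sub>E B). Q (override_on z (w \<circ> \<phi>(s := j)) (insert s A)))"
    unfolding sum.cartesian_product using insert.hyps
    by (intro sum.cong refl) (auto simp: override_on_def intro!: arg_cong[where f = Q])
  also have "\<dots> = (\<Sum>\<phi>\<in>insert s A \<rightarrow>\<^sub>E B. Q (override_on z (w \<circ> \<phi>) (insert s A)))"
    unfolding PiE_insert_eq
    by (subst sum.reindex[OF inj_combinator[OF insert.hyps(2)]]) (simp add: case_prod_unfold)
  finally show ?case .
qed

lemma sum_alternating_supersets:
  assumes "finite S" "A \<subseteq> S"
  shows "(\<Sum>U | U \<in> Pow S \<and> A \<subseteq> U. (-1) ^ card U) = (if A = S then (-1) ^ card S else 0 :: 'a::ring_1)"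
proof (cases "A = S")
  case True
  then have "{U. U \<in> Pow S \<and> A \<subseteq> U} = {S}" by auto
  then show ?thesis using True by simp
next
  case False
  then have "A \<subset> S" using assms by blast
  have "(\<Sum>U | U \<in> Pow S \<and> A \<subseteq> U. (-1) ^ card U) = (0 :: 'a)"
    using card_subsupersets_even_odd[OF assms(1) \<open>A \<subset> S\<close>] assms(1)
    by (intro sum_alternating_cancels) (simp_all add: conj_assoc)
  then show ?thesis using False by simp
qed

lemma sum_onto_eq_sum_permutations:
  assumes "finite S"
  shows "(\<Sum>\<phi> | \<phi> \<in> S \<rightarrow>\<^sub>E S \<and> \<phi> ` S = S. f \<phi>) = (\<Sum>\<sigma> | \<sigma> permutes S. f (restrict \<sigma> S))"
proof (rule sum.reindex_bij_witness[where i = "\<lambda>\<sigma>. restrict \<sigma> S" and j = "\<lambda>\<phi>. restrict_id \<phi> S"])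
  fix \<phi> assume \<phi>: "\<phi> \<in> {\<phi>. \<phi> \<in> S \<rightarrow>\<^sub>E S \<and> \<phi> ` S = S}"
  then have "bij_betw \<phi> S S"
    using assms by (auto simp: bij_betw_def intro: eq_card_imp_inj_on)
  then show "restrict_id \<phi> S \<in> {\<sigma>. \<sigma> permutes S}" by (simp add: permutes_restrict_id)
  show restrict: "restrict (restrict_id \<phi> S) S = \<phi>"
    using \<phi> by (auto simp: fun_eq_iff restrict_id_def PiE_iff extensional_def)
  then show "f (restrict (restrict_id \<phi> S) S) = f \<phi>" by simp
next
  fix \<sigma> assume \<sigma>: "\<sigma> \<in> {\<sigma>. \<sigma> permutes S}"
  then show "restrict_id (restrict \<sigma> S) S = \<sigma>"
    by (auto simp: fun_eq_iff restrict_id_def permutes_not_in)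
  show "restrict \<sigma> S \<in> {\<phi>. \<phi> \<in> S \<rightarrow>\<^sub>E S \<and> \<phi> ` S = S}"
    using \<sigma> permutes_image[of \<sigma> S] by (auto simp: permutes_in_image)
qed

lemma polarisation_identity:
  fixes Q :: "('a \<Rightarrow> 'v::ab_group_add) \<Rightarrow> 'w::ring_1"
  assumes Q: "multi_additive S Q" and S: "finite S"
  shows "(\<Sum>U\<in>Pow S. (-1) ^ card U * Q (override_on z0 (\<lambda>_. \<Sum>j\<in>U. z j) S))
    = (-1) ^ card S * (\<Sum>\<sigma> | \<sigma> permutes S. Q (override_on z0 (z \<circ> \<sigma>) S))"
proof -
  let ?q = "\<lambda>\<phi>. Q (override_on z0 (z \<circ> \<phi>) S)"
  have fin: "finite (S \<rightarrow>\<^sub>E S)" "finite (Pow S)" using S by (simp_all add: finite_PiE)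
  have maps_into: "(S \<rightarrow>\<^sub>E U) = {\<phi>. \<phi> \<in> S \<rightarrow>\<^sub>E S \<and> \<phi> ` S \<subseteq> U}" if "U \<in> Pow S" for U
    using that by (auto simp: PiE_def Pi_def)
  have "(\<Sum>U\<in>Pow S. (-1) ^ card U * Q (override_on z0 (\<lambda>_. \<Sum>j\<in>U. z j) S))
      = (\<Sum>U\<in>Pow S. \<Sum>\<phi> | \<phi> \<in> S \<rightarrow>\<^sub>E S \<and> \<phi> ` S \<subseteq> U. (-1) ^ card U * ?q \<phi>)"
    unfolding multi_additive_expand[OF Q S subset_refl] sum_distrib_left
    by (intro sum.cong) (simp_all only: maps_into)
  also have "\<dots> = (\<Sum>\<phi>\<in>S \<rightarrow>\<^sub>E S. \<Sum>U | U \<in> Pow S \<and> \<phi> ` S \<subseteq> U. (-1) ^ card U * ?q \<phi>)"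
    by (rule sum.swap_restrict[OF fin(2,1)])
  also have "\<dots> = (\<Sum>\<phi>\<in>S \<rightarrow>\<^sub>E S. if \<phi> ` S = S then (-1) ^ card S * ?q \<phi> else 0)"
  proof (rule sum.cong[OF refl])
    fix \<phi> assume "\<phi> \<in> S \<rightarrow>\<^sub>E S"
    then have "\<phi> ` S \<subseteq> S" by auto
    from sum_alternating_supersets[OF S this, where 'a = 'w]
    show "(\<Sum>U | U \<in> Pow S \<and> \<phi> ` S \<subseteq> U. (-1) ^ card U * ?q \<phi>)
        = (if \<phi> ` S = S then (-1) ^ card S * ?q \<phi> else 0)"
      unfolding sum_distrib_right[symmetric] by (simp del: Pow_iff)
  qed
  also have "\<dots> = (-1) ^ card S * (\<Sum>\<phi> | \<phi> \<in> S \<rightarrow>\<^sub>E S \<and> \<phi> ` S = S. ?q \<phi>)"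
    unfolding sum_distrib_left by (rule sum.inter_filter[OF fin(1), symmetric])
  also have "(\<Sum>\<phi> | \<phi> \<in> S \<rightarrow>\<^sub>E S \<and> \<phi> ` S = S. ?q \<phi>) = (\<Sum>\<sigma> | \<sigma> permutes S. ?q (restrict \<sigma> S))"
    by (rule sum_onto_eq_sum_permutations[OF S])
  also have "\<dots> = (\<Sum>\<sigma> | \<sigma> permutes S. ?q \<sigma>)"
    by (intro sum.cong refl arg_cong[where f = Q]) (auto simp: override_on_def)
  finally show ?thesis .
qed

lemma sum_permutations_eq_0_of_diagonal:
  fixes Q :: "('a \<Rightarrow> 'v::ab_group_add) \<Rightarrow> 'w::ring_1"
  assumes "multi_additive S Q" "finite S" "\<And>x. Q (override_on z0 (\<lambda>_. x) S) = 0"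
  shows "(\<Sum>\<sigma> | \<sigma> permutes S. Q (override_on z0 (z \<circ> \<sigma>) S)) = 0"
proof -
  have "(-1) ^ card S * (\<Sum>\<sigma> | \<sigma> permutes S. Q (override_on z0 (z \<circ> \<sigma>) S)) = 0"
    unfolding polarisation_identity[OF assms(1,2), symmetric] by (simp add: assms(3))
  then show ?thesis by (cases "even (card S)") simp_all
qed

section \<open>Trees with prescribed subtrees\<close>

lemma size_nth_less: "i < length ts \<Longrightarrow> size (ts ! i) < Suc (size_list size ts)"
  by (metis less_Suc_eq_le nth_mem size_list_estimation' order_refl)

text \<open>\<open>g\<close> prescribes the values of the subtrees at certain positions, and \<open>\<mu> []\<close> is the value of
  a leaf.\<close>
function tree_eval :: "('v list \<Rightarrow> 'v) \<Rightarrow> (nat list \<Rightarrow> 'v option) \<Rightarrow> ptree \<Rightarrow> 'v" where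
  "tree_eval \<mu> g (Node ts) = (case g [] of Some u \<Rightarrow> u
     | None \<Rightarrow> \<mu> (map (\<lambda>i. tree_eval \<mu> (\<lambda>q. g (i # q)) (ts ! i)) [0..<length ts]))"
  by pat_completeness auto
termination
  by (relation "Wellfounded.measure (\<lambda>(\<mu>, g, t). size t)") (auto simp: size_nth_less)

declare tree_eval.simps[simp del]

abbreviation child_values :: "('v list \<Rightarrow> 'v) \<Rightarrow> (nat list \<Rightarrow> 'v option) \<Rightarrow> ptree list \<Rightarrow> 'v list" where
  "child_values \<mu> g ts \<equiv> map (\<lambda>i. tree_eval \<mu> (\<lambda>q. g (i # q)) (ts ! i)) [0..<length ts]"

abbreviation tree_value :: "('v list \<Rightarrow> 'v) \<Rightarrow> ptree \<Rightarrow> 'v" where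
  "tree_value \<mu> \<equiv> tree_eval \<mu> (\<lambda>_. None)"

abbreviation graft :: "(nat list \<Rightarrow> ptree option) \<Rightarrow> ptree \<Rightarrow> ptree" where
  "graft \<equiv> tree_eval Node"

abbreviation replace_all :: "(nat list \<Rightarrow> ptree) \<Rightarrow> nat list list \<Rightarrow> ptree \<Rightarrow> ptree" where
  "replace_all f xs T \<equiv> foldr (\<lambda>s t. replace t s (f s)) xs T"

lemma tree_eval_Some: "g [] = Some u \<Longrightarrow> tree_eval \<mu> g t = u"
  by (cases t) (simp add: tree_eval.simps)

lemma tree_eval_None: "g [] = None \<Longrightarrow> tree_eval \<mu> g (Node ts) = \<mu> (child_values \<mu> g ts)"
  by (simp add: tree_eval.simps)

lemma tree_value_Node: "tree_value \<mu> (Node ts) = \<mu> (map (tree_value \<mu>) ts)"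
  by (auto simp: tree_eval_None intro!: arg_cong[where f = \<mu>] nth_equalityI)

lemma graft_nothing: "graft (\<lambda>_. None) t = t"
proof (induction t)
  case (Node ts)
  then show ?case by (simp add: tree_value_Node map_idI)
qed

lemma tree_value_graft: "tree_value \<mu> (graft g t) = tree_eval \<mu> (\<lambda>q. map_option (tree_value \<mu>) (g q)) t"
proof (induction t arbitrary: g)
  case (Node ts)
  show ?case
  proof (cases "g []")
    case None
    then have "tree_value \<mu> (graft g (Node ts)) = \<mu> (map (tree_value \<mu>) (child_values Node g ts))"
      by (simp add: tree_eval_None tree_value_Node del: map_map)
    also have "map (tree_value \<mu>) (child_values Node g ts)
        = child_values \<mu> (\<lambda>q. map_option (tree_value \<mu>) (g q)) ts"
      using Node by simp
    finally show ?thesis using None by (simp add: tree_eval_None)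
  qed (simp add: tree_eval_Some)
qed

lemma child_values_list_update:
  "i < length ts \<Longrightarrow>
     child_values \<mu> g (ts[i := u]) = (child_values \<mu> g ts)[i := tree_eval \<mu> (\<lambda>q. g (i # q)) u]"
  by (rule nth_equalityI) (auto simp: nth_list_update)

lemma child_values_fun_upd:
  assumes "i < length ts"
  shows "child_values \<mu> (g(i # s \<mapsto> c)) ts
    = (child_values \<mu> g ts)[i := tree_eval \<mu> ((\<lambda>q. g (i # q))(s \<mapsto> c)) (ts ! i)]"
proof -
  have "(\<lambda>q. (g(i # s \<mapsto> c)) (j # q)) = (if j = i then (\<lambda>q. g (i # q))(s \<mapsto> c) else (\<lambda>q. g (j # q)))" for j
    by auto
  then show ?thesis using assms
    by (intro nth_equalityI) (simp_all add: nth_list_update del: fun_upd_apply)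
qed

lemma Cons_parallel_Cons: "i # p \<parallel> j # q \<longleftrightarrow> i \<noteq> j \<or> p \<parallel> q"
  by (auto simp: parallel_def)

lemma
  assumes "q \<parallel> s"
  shows is_pos_replace_parallel: "is_pos (replace t s u) q = is_pos t q"
    and subt_replace_parallel: "is_pos t q \<Longrightarrow> subt (replace t s u) q = subt t q"
proof -
  have "is_pos (replace t s u) q = is_pos t q \<and> (is_pos t q \<longrightarrow> subt (replace t s u) q = subt t q)"
    using assms
  proof (induction s arbitrary: q t)
    case (Cons i s)
    obtain ts where t: "t = Node ts" by (cases t)
    from Cons.prems obtain j q' where "q = j # q'" by (cases q) auto
    with Cons show ?case by (cases "i = j") (auto simp: t Cons_parallel_Cons)
  qed simp
  then show "is_pos (replace t s u) q = is_pos t q"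
    and "is_pos t q \<Longrightarrow> subt (replace t s u) q = subt t q" by blast+
qed

lemma graft_replace:
  assumes "is_pos t s" "\<forall>q\<in>dom g. q \<parallel> s"
  shows "graft g (replace t s u) = graft (g(s \<mapsto> u)) t"
  using assms
proof (induction s arbitrary: t g)
  case Nil
  then have "g = (\<lambda>_. None)" by (auto simp: dom_def fun_eq_iff)
  then show ?case by (simp add: tree_eval_Some graft_nothing)
next
  case (Cons i s)
  obtain ts where t: "t = Node ts" by (cases t)
  have child: "i < length ts" "is_pos (ts ! i) s" using Cons.prems by (auto simp: t)
  have "g [] = None" using Cons.prems(2) by (auto simp: dom_def)
  then have "graft g (replace t (i # s) u)
      = Node ((child_values Node g ts)[i := graft (\<lambda>q. g (i # q)) (replace (ts ! i) s u)])"
    using child(1) by (simp add: t tree_eval_None child_values_list_update del: length_list_update)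
  also have "graft (\<lambda>q. g (i # q)) (replace (ts ! i) s u) = graft ((\<lambda>q. g (i # q))(s \<mapsto> u)) (ts ! i)"
    using Cons.prems(2) by (intro Cons.IH child(2)) (auto simp: dom_def Cons_parallel_Cons)
  also have "Node ((child_values Node g ts)[i := \<dots>]) = graft (g(i # s \<mapsto> u)) t"
    using \<open>g [] = None\<close> child(1)
    by (simp add: t tree_eval_None child_values_fun_upd fun_upd_other del: fun_upd_apply)
  finally show ?case .
qed

lemma
  assumes "\<forall>s\<in>set xs. q \<parallel> s"
  shows is_pos_replace_all: "is_pos (replace_all f xs T) q = is_pos T q"
    and subt_replace_all: "is_pos T q \<Longrightarrow> subt (replace_all f xs T) q = subt T q"
  using assms by (induction xs) (auto simp: is_pos_replace_parallel subt_replace_parallel)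

lemma graft_replace_all:
  assumes "distinct xs" "set xs \<subseteq> vertices T" "pairwise parallel (set xs)"
    "\<forall>q\<in>dom g. \<forall>s\<in>set xs. q \<parallel> s"
  shows "graft g (replace_all f xs T)
       = graft (\<lambda>q. if q \<in> set xs then Some (f q) else g q) T"
  using assms
proof (induction xs arbitrary: g)
  case Nil
  then show ?case by simp
next
  case (Cons s xs)
  let ?R = "replace_all f xs T"
  have par: "\<forall>s'\<in>set xs. s \<parallel> s'" using Cons.prems(1,3) by (auto simp: pairwise_insert)
  have "is_pos ?R s" using is_pos_replace_all[OF par] Cons.prems(2) by (simp add: vertices_def)
  then have "graft g (replace ?R s (f s)) = graft (g(s \<mapsto> f s)) ?R"
    using Cons.prems(4) by (intro graft_replace) auto
  also have "\<dots> = graft (\<lambda>q. if q \<in> set xs then Some (f q) else (g(s \<mapsto> f s)) q) T"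
    using Cons.prems par by (intro Cons.IH) (auto simp: pairwise_insert split: if_splits)
  also have "(\<lambda>q. if q \<in> set xs then Some (f q) else (g(s \<mapsto> f s)) q)
      = (\<lambda>q. if q \<in> set (s # xs) then Some (f q) else g q)"
    using Cons.prems(1) by auto
  finally show ?case by simp
qed

lemma subt_graft:
  assumes "is_pos t s" "g s = Some u" "\<forall>q\<in>dom g. q \<noteq> s \<longrightarrow> q \<parallel> s"
  shows "subt (graft g t) s = u"
  using assms
proof (induction s arbitrary: t g)
  case Nil
  then show ?case by (simp add: tree_eval_Some)
next
  case (Cons i s)
  obtain ts where t: "t = Node ts" by (cases t)
  have "g [] = None" using Cons.prems(3) by (auto simp: dom_def)
  moreover have "subt (graft (\<lambda>q. g (i # q)) (ts ! i)) s = u"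
    using Cons.prems by (intro Cons.IH) (auto simp: t dom_def Cons_parallel_Cons)
  ultimately show ?case using Cons.prems(1) by (simp add: t tree_eval_None)
qed

section \<open>Catalan trees\<close>

fun num_internal :: "ptree \<Rightarrow> nat" where
  "num_internal (Node ts) = (if ts = [] then 0 else Suc (sum_list (map num_internal ts)))"

lemma vertices_Node: "vertices (Node ts) = insert [] (\<Union>i<length ts. (#) i ` vertices (ts ! i))"
proof -
  have "q \<in> vertices (Node ts) \<longleftrightarrow> q \<in> insert [] (\<Union>i<length ts. (#) i ` vertices (ts ! i))" for q
    by (cases q) (auto simp: vertices_def)
  then show ?thesis by blast
qed

lemma finite_vertices: "finite (vertices t)"
  by (induction t) (auto simp: vertices_Node)

lemma is_catalan_Node:
  "is_catalan d (Node ts) \<longleftrightarrow> (length ts = 0 \<or> length ts = d) \<and> (\<forall>t\<in>set ts. is_catalan d t)"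
  by (auto simp: is_catalan_def vertices_Node all_set_conv_all_nth)

lemma card_internal_vertices: "card (internal_vertices t) = num_internal t"
proof (induction t)
  case (Node ts)
  let ?proper = "\<Union>i<length ts. (#) i ` internal_vertices (ts ! i)"
  have fin: "finite (internal_vertices t)" for t
    by (simp add: internal_vertices_def finite_vertices)
  have split_root: "internal_vertices (Node ts) = (if ts = [] then {} else insert [] ?proper)"
    by (auto simp: internal_vertices_def vertices_Node)
  have "card ?proper = (\<Sum>i<length ts. card ((#) i ` internal_vertices (ts ! i)))"
    by (rule card_UN_disjoint) (auto simp: fin)
  also have "\<dots> = (\<Sum>i<length ts. num_internal (ts ! i))"
    using Node by (intro sum.cong refl) (simp add: card_image)
  also have "\<dots> = sum_list (map num_internal ts)"
    by (simp add: sum_list_sum_nth atLeast0LessThan)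
  finally have "card ?proper = sum_list (map num_internal ts)" .
  moreover have "[] \<notin> ?proper" by auto
  ultimately show ?case unfolding split_root by (simp add: card_insert_disjoint fin)
qed

lemma catalan_trees_alt: "catalan_trees d k = {t. is_catalan d t \<and> num_internal t = k}"
  by (simp add: catalan_trees_def card_internal_vertices)

lemma num_internal_replace:
  "is_pos t s \<Longrightarrow> num_internal (replace t s u) + num_internal (subt t s) = num_internal t + num_internal u"
proof (induction s arbitrary: t)
  case Nil
  then show ?case by simp
next
  case (Cons i s)
  obtain ts where t: "t = Node ts" by (cases t)
  have "i < length ts" and IH: "num_internal (replace (ts ! i) s u) + num_internal (subt (ts ! i) s)
      = num_internal (ts ! i) + num_internal u"
    using Cons by (auto simp: t)
  then have "num_internal (ts ! i) \<le> sum_list (map num_internal ts)"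
    using elem_le_sum_list[of i "map num_internal ts"] by simp
  then have "sum_list (map num_internal (ts[i := r])) + num_internal (ts ! i)
      = sum_list (map num_internal ts) + num_internal r" for r
    using \<open>i < length ts\<close> by (simp add: map_update sum_list_update)
  from this[of "replace (ts ! i) s u"] show ?case using \<open>i < length ts\<close> IH by (auto simp: t)
qed

lemma is_catalan_replace:
  "is_catalan d t \<Longrightarrow> is_catalan d u \<Longrightarrow> is_pos t s \<Longrightarrow> is_catalan d (replace t s u)"
proof (induction s arbitrary: t)
  case Nil
  then show ?case by simp
next
  case (Cons i s)
  then show ?case
    by (cases t) (auto simp: is_catalan_Node dest!: set_update_subset_insert[THEN subsetD])
qed

lemma is_catalan_subt: "is_catalan d t \<Longrightarrow> is_pos t s \<Longrightarrow> is_catalan d (subt t s)"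
proof (induction s arbitrary: t)
  case (Cons i s)
  then show ?case by (cases t) (auto simp: is_catalan_Node)
qed simp

lemma catalan_replace_all:
  assumes "distinct xs" "set xs \<subseteq> vertices T" "pairwise parallel (set xs)"
    "is_catalan d T" "\<forall>s\<in>set xs. is_catalan d (f s)"
  defines "R \<equiv> replace_all f xs T"
  shows "is_catalan d R"
    and "num_internal R + (\<Sum>s\<in>set xs. num_internal (subt T s))
         = num_internal T + (\<Sum>s\<in>set xs. num_internal (f s))"
proof -
  have "is_catalan d R \<and> num_internal R + (\<Sum>s\<in>set xs. num_internal (subt T s))
      = num_internal T + (\<Sum>s\<in>set xs. num_internal (f s))"
    using assms(1-5) unfolding R_def
  proof (induction xs)
    case (Cons s xs)
    let ?R = "replace_all f xs T"
    have IH: "is_catalan d ?R" "num_internal ?R + (\<Sum>s\<in>set xs. num_internal (subt T s))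
        = num_internal T + (\<Sum>s\<in>set xs. num_internal (f s))"
      using Cons by (auto simp: pairwise_insert)
    have par: "\<forall>s'\<in>set xs. s \<parallel> s'" using Cons.prems(1,3) by (auto simp: pairwise_insert)
    have pos: "is_pos ?R s" "subt ?R s = subt T s"
      using is_pos_replace_all[OF par] subt_replace_all[OF par] Cons.prems(2)
      by (simp_all add: vertices_def)
    have "is_catalan d (replace ?R s (f s))"
      using Cons.prems(5) by (intro is_catalan_replace IH pos) simp
    moreover have "num_internal (replace ?R s (f s)) + num_internal (subt T s)
        = num_internal ?R + num_internal (f s)"
      using num_internal_replace[OF pos(1)] pos(2) by simp
    ultimately show ?case using IH(2) Cons.prems(1) by simp
  qed simp
  then show "is_catalan d R" "num_internal R + (\<Sum>s\<in>set xs. num_internal (subt T s))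
      = num_internal T + (\<Sum>s\<in>set xs. num_internal (f s))" by blast+
qed

lemma in_listset_iff: "xs \<in> listset Bs \<longleftrightarrow> list_all2 (\<in>) xs Bs"
  by (induction Bs arbitrary: xs) (auto simp: set_Cons_def list_all2_Cons2)

lemma listset_Cons_eq_image: "listset (B # Bs) = (\<lambda>(x, xs). x # xs) ` (B \<times> listset Bs)"
  by (auto simp: set_Cons_def)

lemma finite_listset: "\<forall>B\<in>set Bs. finite B \<Longrightarrow> finite (listset Bs)"
  by (induction Bs) (auto simp: listset_Cons_eq_image simp del: listset.simps(2))

lemma finite_compositions: "finite {ks :: nat list. length ks = d \<and> sum_list ks = k}"
  by (rule finite_subset[OF _ finite_lists_length_eq[of "{..k}" d]]) (auto dest: member_le_sum_list)

lemma catalan_trees_0: "catalan_trees d 0 = {Node []}"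
proof -
  have "t \<in> catalan_trees d 0 \<longleftrightarrow> t = Node []" for t
    by (cases t) (auto simp: catalan_trees_alt is_catalan_Node)
  then show ?thesis by blast
qed

lemma in_listset_catalan_trees:
  "ts \<in> listset (map (catalan_trees d) ks) \<longleftrightarrow> (\<forall>t\<in>set ts. is_catalan d t) \<and> map num_internal ts = ks"
  unfolding in_listset_iff
  by (induction ts arbitrary: ks) (auto simp: list_all2_Cons1 list_all2_map2 catalan_trees_alt)

lemma catalan_trees_Suc:
  assumes "0 < d"
  shows "catalan_trees d (Suc k)
       = Node ` (\<Union>ks\<in>{ks. length ks = d \<and> sum_list ks = k}. listset (map (catalan_trees d) ks))"
    (is "?l = ?r")
proof -
  have "t \<in> ?l \<longleftrightarrow> t \<in> ?r" for t
  proof (cases t)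
    case (Node ts)
    then show ?thesis using assms
      by (auto simp: catalan_trees_alt is_catalan_Node in_listset_catalan_trees image_iff split: if_splits)
  qed
  then show ?thesis by blast
qed

lemma finite_catalan_trees:
  assumes "0 < d"
  shows "finite (catalan_trees d k)"
proof (induction k rule: less_induct)
  case (less k)
  show ?case
  proof (cases k)
    case 0
    then show ?thesis by (simp add: catalan_trees_0)
  next
    case (Suc k')
    have "finite (listset (map (catalan_trees d) ks))" if "sum_list ks = k'" for ks
      using that less Suc by (intro finite_listset) (auto dest: member_le_sum_list simp: less_Suc_eq_le)
    then show ?thesis unfolding Suc catalan_trees_Suc[OF assms]
      by (intro finite_imageI finite_UN_I finite_compositions) auto
  qed
qed

section \<open>Shuffle classes\<close>

lemma sibling_positions_Nil [simp]: "sibling_positions d p [] = {}"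
  by (auto simp: sibling_positions_def)

lemma sibling_positions_Cons:
  "sibling_positions d p (i # v)
     = (if length v < p then (\<lambda>c. [c]) ` ({..<d} - {i}) else {}) \<union> (#) i ` sibling_positions d p v"
    (is "_ = ?firsts \<union> ?deeper")
proof (rule set_eqI)
  fix q
  have ex_nat: "(\<exists>j. R j) \<longleftrightarrow> R 0 \<or> (\<exists>j. R (Suc j))" for R
    by (metis not0_implies_Suc)
  have "q \<in> sibling_positions d p (i # v) \<longleftrightarrow> (\<exists>c. q = [c] \<and> length v < p \<and> c < d \<and> c \<noteq> i)
      \<or> (\<exists>j c. q = i # take j v @ [c] \<and> length v - p \<le> j \<and> j < length v \<and> c < d \<and> c \<noteq> v ! j)"
    unfolding sibling_positions_def mem_Collect_eq by (subst ex_nat) auto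
  also have "\<dots> \<longleftrightarrow> q \<in> ?firsts \<or> q \<in> ?deeper"
    by (intro arg_cong2[where f = "(\<or>)"]) (auto simp: sibling_positions_def)
  finally show "q \<in> sibling_positions d p (i # v) \<longleftrightarrow> q \<in> ?firsts \<union> ?deeper"
    by simp
qed

lemma Nil_notin_sibling_positions: "[] \<notin> sibling_positions d p v"
  by (auto simp: sibling_positions_def)

lemma Cons_in_sibling_positions:
  "j # q \<in> sibling_positions d p (i # v)
     \<longleftrightarrow> (if j = i then q \<in> sibling_positions d p v else q = [] \<and> j < d \<and> length v < p)"
  by (auto simp: sibling_positions_Cons Nil_notin_sibling_positions)

lemma finite_sibling_positions: "finite (sibling_positions d p v)"
  by (induction v) (auto simp: sibling_positions_Cons)

lemma pairwise_parallel_sibling_positions: "pairwise parallel (sibling_positions d p v)"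
proof (induction v)
  case (Cons i v)
  show ?case
  proof (rule pairwiseI)
    fix s s'
    assume s: "s \<in> sibling_positions d p (i # v)" "s' \<in> sibling_positions d p (i # v)" "s \<noteq> s'"
    then obtain j q j' q' where Cons_eq: "s = j # q" "s' = j' # q'"
      by (metis Nil_notin_sibling_positions list.exhaust)
    have "q \<parallel> q'" if "j = j'"
      using s that pairwiseD[OF Cons.IH, of q q']
      by (auto simp: Cons_eq Cons_in_sibling_positions split: if_splits)
    then show "s \<parallel> s'" by (auto simp: Cons_eq Cons_parallel_Cons)
  qed
qed simp

lemma sibling_positions_subset_vertices:
  "is_catalan d T \<Longrightarrow> v \<in> vertices T \<Longrightarrow> sibling_positions d p v \<subseteq> vertices T"
proof (induction v arbitrary: T)
  case (Cons i v)
  obtain ts where T: "T = Node ts" by (cases T)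
  have child: "length ts = d" "is_catalan d (ts ! i)" "v \<in> vertices (ts ! i)"
    using Cons.prems by (auto simp: T vertices_def is_catalan_Node)
  show ?case
  proof
    fix s assume s: "s \<in> sibling_positions d p (i # v)"
    then obtain j q where Cons_eq: "s = j # q"
      by (metis Nil_notin_sibling_positions list.exhaust)
    have "q \<in> vertices (ts ! i)" if "j = i"
      using s that Cons.IH[OF child(2,3)] by (auto simp: Cons_eq Cons_in_sibling_positions)
    then show "s \<in> vertices T"
      using s Cons.prems(2) child(1)
      by (auto simp: Cons_eq T vertices_def Cons_in_sibling_positions split: if_splits)
  qed
qed simp

abbreviation substitute :: "nat list set \<Rightarrow> (nat list \<Rightarrow> 'v) \<Rightarrow> nat list \<Rightarrow> 'v option" where
  "substitute S z \<equiv> \<lambda>q. if q \<in> S then Some (z q) else None"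

definition shuffled :: "ptree \<Rightarrow> nat list set \<Rightarrow> (nat list \<Rightarrow> nat list) \<Rightarrow> ptree" where
  "shuffled T S \<sigma> = graft (substitute S (\<lambda>q. subt T (\<sigma> q))) T"

lemma rearrange_eq_shuffled:
  assumes "distinct xs" "set xs \<subseteq> vertices T" "pairwise parallel (set xs)"
  shows "rearrange T xs \<sigma> = shuffled T (set xs) \<sigma>"
  using graft_replace_all[OF assms, of "\<lambda>_. None" "\<lambda>s. subt T (\<sigma> s)"]
  by (simp add: rearrange_def shuffled_def graft_nothing)

lemma tree_value_shuffled:
  "tree_value \<mu> (shuffled T S \<sigma>) = tree_eval \<mu> (substitute S (\<lambda>q. tree_value \<mu> (subt T (\<sigma> q)))) T"
  unfolding shuffled_def tree_value_graft by (rule arg_cong[where f = "\<lambda>g. tree_eval \<mu> g T"]) auto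

lemma shuffled_eq_iff:
  assumes "S \<subseteq> vertices T" "pairwise parallel S"
  shows "shuffled T S \<sigma> = shuffled T S \<tau> \<longleftrightarrow> (\<forall>s\<in>S. subt T (\<sigma> s) = subt T (\<tau> s))"
proof
  have subt_shuffled: "subt (shuffled T S \<sigma>) s = subt T (\<sigma> s)" if "s \<in> S" for s \<sigma>
    unfolding shuffled_def using assms that
    by (intro subt_graft) (auto simp: vertices_def pairwise_def dom_def split: if_splits)
  assume "shuffled T S \<sigma> = shuffled T S \<tau>"
  then show "\<forall>s\<in>S. subt T (\<sigma> s) = subt T (\<tau> s)" using subt_shuffled by metis
next
  assume "\<forall>s\<in>S. subt T (\<sigma> s) = subt T (\<tau> s)"
  then have "substitute S (\<lambda>q. subt T (\<sigma> q)) = substitute S (\<lambda>q. subt T (\<tau> q))" by auto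
  then show "shuffled T S \<sigma> = shuffled T S \<tau>" by (simp add: shuffled_def)
qed

lemma shuffle_class_eq_image:
  assumes "is_catalan d T" "v \<in> vertices T"
  shows "shuffle_class d T p v
       = shuffled T (sibling_positions d p v) ` {\<sigma>. \<sigma> permutes sibling_positions d p v}"
proof -
  have "rearrange T xs \<sigma> = shuffled T (sibling_positions d p v) \<sigma>"
    if "distinct xs" "set xs = sibling_positions d p v" for xs \<sigma>
    using rearrange_eq_shuffled[of xs T \<sigma>] that sibling_positions_subset_vertices[OF assms]
      pairwise_parallel_sibling_positions by metis
  moreover obtain xs where "distinct xs" "set xs = sibling_positions d p v"
    using finite_distinct_list[OF finite_sibling_positions] by metis
  ultimately show ?thesis unfolding shuffle_class_def by (auto simp: image_def) metis+
qed

lemma shuffle_class_subset_catalan_trees: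
  assumes T: "T \<in> catalan_trees d k" and v: "v \<in> vertices T"
  shows "shuffle_class d T p v \<subseteq> catalan_trees d k"
proof
  fix T' assume "T' \<in> shuffle_class d T p v"
  then obtain xs \<sigma> where xs: "distinct xs" "set xs = sibling_positions d p v"
    and \<sigma>: "\<sigma> permutes set xs" and T': "T' = rearrange T xs \<sigma>"
    by (auto simp: shuffle_class_def)
  have cat: "is_catalan d T" using T by (simp add: catalan_trees_alt)
  have sub: "set xs \<subseteq> vertices T" using sibling_positions_subset_vertices[OF cat v] xs(2) by simp
  have par: "pairwise parallel (set xs)" using pairwise_parallel_sibling_positions xs(2) by metis
  have "\<forall>s\<in>set xs. is_catalan d (subt T (\<sigma> s))"
    using is_catalan_subt[OF cat] sub permutes_in_image[OF \<sigma>] by (auto simp: vertices_def)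
  note rearranged = catalan_replace_all[OF xs(1) sub par cat this]
  have "(\<Sum>s\<in>set xs. num_internal (subt T (\<sigma> s))) = (\<Sum>s\<in>set xs. num_internal (subt T s))"
    using sum.permute[OF \<sigma>, of "\<lambda>s. num_internal (subt T s)"] by (simp add: o_def)
  then show "T' \<in> catalan_trees d k"
    using rearranged T by (simp add: catalan_trees_alt T' rearrange_def)
qed

definition label_stabiliser :: "('a \<Rightarrow> 'b) \<Rightarrow> 'a set \<Rightarrow> ('a \<Rightarrow> 'a) set" where
  "label_stabiliser f S = {\<sigma>. \<sigma> permutes S \<and> (\<forall>s\<in>S. f (\<sigma> s) = f s)}"

lemma card_label_stabiliser_pos:
  assumes "finite S"
  shows "0 < card (label_stabiliser f S)"
proof -
  have "finite (label_stabiliser f S)"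
    by (rule finite_subset[OF _ finite_permutations[OF assms]]) (auto simp: label_stabiliser_def)
  moreover have "id \<in> label_stabiliser f S" by (simp add: label_stabiliser_def permutes_id)
  ultimately show ?thesis by (auto simp: card_gt_0_iff)
qed

lemma card_permutations_same_labels:
  assumes \<tau>: "\<tau> permutes S"
  shows "card {\<sigma>. \<sigma> permutes S \<and> (\<forall>s\<in>S. f (\<sigma> s) = f (\<tau> s))} = card (label_stabiliser f S)"
proof (rule bij_betw_same_card[of "\<lambda>\<sigma>. \<sigma> \<circ> inv \<tau>"],
    rule bij_betw_byWitness[where f' = "\<lambda>\<rho>. \<rho> \<circ> \<tau>"])
  have inv: "inv \<tau> permutes S" using \<tau> by (rule permutes_inv)
  note inverses = permutes_inverses[OF \<tau>]
  let ?same_labels = "{\<sigma>. \<sigma> permutes S \<and> (\<forall>s\<in>S. f (\<sigma> s) = f (\<tau> s))}"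
  show "\<forall>\<sigma>\<in>?same_labels. (\<sigma> \<circ> inv \<tau>) \<circ> \<tau> = \<sigma>"
    and "\<forall>\<rho>\<in>label_stabiliser f S. (\<rho> \<circ> \<tau>) \<circ> inv \<tau> = \<rho>"
    by (simp_all add: fun_eq_iff inverses)
  show "(\<lambda>\<sigma>. \<sigma> \<circ> inv \<tau>) ` ?same_labels \<subseteq> label_stabiliser f S"
    using permutes_compose[OF inv] permutes_in_image[OF inv] inverses by (auto simp: label_stabiliser_def)
  show "(\<lambda>\<rho>. \<rho> \<circ> \<tau>) ` label_stabiliser f S \<subseteq> ?same_labels"
    using permutes_compose[OF \<tau>] permutes_in_image[OF \<tau>] by (auto simp: label_stabiliser_def)
qed

lemma sum_permutations_eq_sum_shuffle_class:
  fixes \<psi> :: "ptree \<Rightarrow> 'a::semiring_1" and p :: nat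
  assumes T: "is_catalan d T" and v: "v \<in> vertices T"
  defines "S \<equiv> sibling_positions d p v"
  shows "(\<Sum>\<sigma> | \<sigma> permutes S. \<psi> (shuffled T S \<sigma>))
       = of_nat (card (label_stabiliser (subt T) S)) * (\<Sum>T'\<in>shuffle_class d T p v. \<psi> T')"
proof -
  have fin: "finite {\<sigma>. \<sigma> permutes S}"
    by (simp add: S_def finite_permutations finite_sibling_positions)
  have class_eq: "shuffle_class d T p v = shuffled T S ` {\<sigma>. \<sigma> permutes S}"
    unfolding S_def by (rule shuffle_class_eq_image[OF T v])
  have eq_iff: "shuffled T S \<sigma> = shuffled T S \<tau> \<longleftrightarrow> (\<forall>s\<in>S. subt T (\<sigma> s) = subt T (\<tau> s))" for \<sigma> \<tau>
    unfolding S_def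
    by (intro shuffled_eq_iff sibling_positions_subset_vertices[OF T v] pairwise_parallel_sibling_positions)
  have "(\<Sum>\<sigma> | \<sigma> permutes S. \<psi> (shuffled T S \<sigma>))
      = (\<Sum>T'\<in>shuffle_class d T p v.
          of_nat (card {\<sigma> \<in> {\<sigma>. \<sigma> permutes S}. shuffled T S \<sigma> = T'}) * \<psi> T')"
    unfolding class_eq using fin by (intro sum_fun_comp) simp_all
  also have "\<dots> = (\<Sum>T'\<in>shuffle_class d T p v. of_nat (card (label_stabiliser (subt T) S)) * \<psi> T')"
    unfolding class_eq using card_permutations_same_labels[where f = "subt T"]
    by (intro sum.cong refl) (auto simp: eq_iff)
  finally show ?thesis by (simp add: sum_distrib_left)
qed

section \<open>Stationarity of the uniform distribution\<close>

lemma sum_shuffle_trans: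
  fixes f :: "ptree \<Rightarrow> 'a::real_vector"
  assumes "0 < d" and T: "T \<in> catalan_trees d k"
  shows "(\<Sum>T'\<in>catalan_trees d k. shuffle_trans d p P T T' *\<^sub>R f T')
       = (\<Sum>v\<in>vertices T. (P T v / card (shuffle_class d T p v)) *\<^sub>R (\<Sum>T'\<in>shuffle_class d T p v. f T'))"
proof -
  let ?C = "catalan_trees d k" and ?Sh = "\<lambda>v. shuffle_class d T p v"
  have "(\<Sum>T'\<in>?C. shuffle_trans d p P T T' *\<^sub>R f T')
      = (\<Sum>v\<in>vertices T. \<Sum>T'\<in>?C. if T' \<in> ?Sh v then (P T v / card (?Sh v)) *\<^sub>R f T' else 0)"
    unfolding shuffle_trans_def scaleR_sum_left by (subst sum.swap) (intro sum.cong refl, simp)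
  also have "\<dots> = (\<Sum>v\<in>vertices T. \<Sum>T'\<in>?Sh v. (P T v / card (?Sh v)) *\<^sub>R f T')"
  proof (rule sum.cong[OF refl])
    fix v assume "v \<in> vertices T"
    then have "?C \<inter> ?Sh v = ?Sh v" using shuffle_class_subset_catalan_trees[OF T] by blast
    then show "(\<Sum>T'\<in>?C. if T' \<in> ?Sh v then (P T v / card (?Sh v)) *\<^sub>R f T' else 0)
        = (\<Sum>T'\<in>?Sh v. (P T v / card (?Sh v)) *\<^sub>R f T')"
      by (simp add: sum.inter_restrict[OF finite_catalan_trees[OF \<open>0 < d\<close>], symmetric])
  qed
  finally show ?thesis by (simp add: scaleR_sum_right)
qed

lemma sum_catalan_trees_eq_0_if_shuffle_classes:
  fixes f :: "ptree \<Rightarrow> 'a::real_vector"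
  assumes "0 < d"
    and P: "is_shuffle_family d p k P" "uniform_stationary d p k P"
    and classes: "\<And>T v. T \<in> catalan_trees d k \<Longrightarrow> v \<in> vertices T \<Longrightarrow> p \<le> length v \<Longrightarrow>
      (\<Sum>T'\<in>shuffle_class d T p v. f T') = 0"
  shows "(\<Sum>T\<in>catalan_trees d k. f T) = 0"
proof -
  let ?C = "catalan_trees d k"
  have inflow: "(\<Sum>T\<in>?C. shuffle_trans d p P T T') = 1" if "T' \<in> ?C" for T'
  proof -
    have "real (card ?C) \<noteq> 0" using that finite_catalan_trees[OF \<open>0 < d\<close>] by auto
    moreover have "(1 / real (card ?C)) * (\<Sum>T\<in>?C. shuffle_trans d p P T T') = 1 / real (card ?C)"
      using P(2) that by (simp add: uniform_stationary_def sum_distrib_left)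
    ultimately show ?thesis by simp
  qed
  have expectation: "(\<Sum>T'\<in>?C. shuffle_trans d p P T T' *\<^sub>R f T') = 0" if T: "T \<in> ?C" for T
    unfolding sum_shuffle_trans[OF \<open>0 < d\<close> T]
  proof (rule sum.neutral, rule ballI)
    fix v assume v: "v \<in> vertices T"
    have "P T v = 0" if "\<not> p \<le> length v"
      using P(1) T v that unfolding is_shuffle_family_def by force
    then show "(P T v / card (shuffle_class d T p v)) *\<^sub>R (\<Sum>T'\<in>shuffle_class d T p v. f T') = 0"
      using classes[OF T v] by (cases "p \<le> length v") simp_all
  qed
  have "(\<Sum>T'\<in>?C. f T') = (\<Sum>T'\<in>?C. (\<Sum>T\<in>?C. shuffle_trans d p P T T') *\<^sub>R f T')"
    by (simp add: inflow)
  also have "\<dots> = (\<Sum>T\<in>?C. \<Sum>T'\<in>?C. shuffle_trans d p P T T' *\<^sub>R f T')"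
    unfolding scaleR_sum_left by (rule sum.swap)
  also have "\<dots> = 0" using expectation by simp
  finally show ?thesis .
qed

section \<open>Symmetric multiadditive operations\<close>

lemma mset_replicate_update:
  assumes "i < n"
  shows "mset ((replicate n x)[i := h]) = mset (h # replicate (n - 1) x)"
  using assms mset_update[of i "replicate n x" h] by (cases n) (simp_all del: replicate_Suc nth_Cons')

locale symmetric_multi_additive =
  fixes d :: nat and \<mu> :: "'v::ab_group_add list \<Rightarrow> 'v"
  assumes d_pos: "0 < d"
    and additive_arg: "length xs = d \<Longrightarrow> j < d \<Longrightarrow> Modules.additive (\<lambda>a. \<mu> (xs[j := a]))"
    and symmetric: "length xs = d \<Longrightarrow> mset xs = mset ys \<Longrightarrow> \<mu> xs = \<mu> ys"
begin

definition mult_op :: "'v \<Rightarrow> 'v \<Rightarrow> 'v" where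
  "mult_op x h = \<mu> (h # replicate (d - 1) x)"

lemma mu_zero_in_set: "length xs = d \<Longrightarrow> 0 \<in> set xs \<Longrightarrow> \<mu> xs = 0"
  by (metis in_set_conv_nth list_update_id additive.zero[OF additive_arg])

lemma mu_replicate_update:
  assumes "i < d"
  shows "\<mu> ((replicate d x)[i := h]) = mult_op x h"
  unfolding mult_op_def using mset_replicate_update[OF assms] by (intro symmetric) simp_all

lemma mu_listset:
  assumes "length pre + length Bs = d"
  shows "\<mu> (pre @ map (\<lambda>B. \<Sum>a\<in>B. w a) Bs) = (\<Sum>as\<in>listset Bs. \<mu> (pre @ map w as))"
  using assms
proof (induction Bs arbitrary: pre)
  case Nil
  then show ?case by simp
next
  case (Cons B Bs)
  let ?f = "\<lambda>B. \<Sum>a\<in>B. w a"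
  have "\<mu> (pre @ map ?f (B # Bs)) = \<mu> ((pre @ 0 # map ?f Bs)[length pre := ?f B])"
    by simp
  also have "\<dots> = (\<Sum>a\<in>B. \<mu> ((pre @ 0 # map ?f Bs)[length pre := w a]))"
    using Cons.prems by (intro additive.sum additive_arg) auto
  also have "\<dots> = (\<Sum>a\<in>B. \<mu> ((pre @ [w a]) @ map ?f Bs))" by simp
  also have "\<dots> = (\<Sum>a\<in>B. \<Sum>as\<in>listset Bs. \<mu> ((pre @ [w a]) @ map w as))"
    using Cons.prems by (intro sum.cong refl Cons.IH) auto
  also have "\<dots> = (\<Sum>as\<in>listset (B # Bs). \<mu> (pre @ map w as))"
    unfolding listset_Cons_eq_image sum.cartesian_product
    by (subst sum.reindex) (auto simp: inj_on_def case_prod_unfold)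
  finally show ?case .
qed

lemma additive_tree_eval:
  assumes "is_catalan d T" "is_pos T s" "\<forall>q\<in>dom g. q \<noteq> s \<longrightarrow> q \<parallel> s"
  shows "Modules.additive (\<lambda>a. tree_eval \<mu> (g(s \<mapsto> a)) T)"
  using assms
proof (induction s arbitrary: T g)
  case Nil
  then show ?case by (simp add: tree_eval_Some Modules.additive_def)
next
  case (Cons i s)
  obtain ts where T: "T = Node ts" by (cases T)
  have child: "i < length ts" "is_pos (ts ! i) s" "is_catalan d (ts ! i)" "length ts = d"
    using Cons.prems by (auto simp: T is_catalan_Node)
  have "g [] = None" using Cons.prems(3) by (auto simp: dom_def)
  then have at_child: "tree_eval \<mu> (g(i # s \<mapsto> c)) T
      = \<mu> ((child_values \<mu> g ts)[i := tree_eval \<mu> ((\<lambda>q. g (i # q))(s \<mapsto> c)) (ts ! i)])" for c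
    using child(1) by (simp add: T tree_eval_None child_values_fun_upd fun_upd_other del: fun_upd_apply)
  have "Modules.additive (\<lambda>a. tree_eval \<mu> ((\<lambda>q. g (i # q))(s \<mapsto> a)) (ts ! i))"
    using Cons.prems(3) child by (intro Cons.IH) (auto simp: dom_def Cons_parallel_Cons)
  moreover have "Modules.additive (\<lambda>a. \<mu> ((child_values \<mu> g ts)[i := a]))"
    using child by (intro additive_arg) simp_all
  ultimately show ?case unfolding at_child by (simp add: Modules.additive_def)
qed

lemma tree_eval_siblings_along_path:
  assumes "is_catalan d T" "is_pos T v" "length v \<le> p"
  shows "tree_eval \<mu> (substitute (sibling_positions d p v) (\<lambda>_. x)) T
       = (mult_op x ^^ length v) (tree_value \<mu> (subt T v))"
  using assms
proof (induction v arbitrary: T)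
  case Nil
  then show ?case by simp
next
  case (Cons i v)
  obtain ts where T: "T = Node ts" by (cases T)
  have child: "i < d" "is_pos (ts ! i) v" "is_catalan d (ts ! i)" "length ts = d"
    using Cons.prems by (auto simp: T is_catalan_Node)
  let ?g = "substitute (sibling_positions d p (i # v)) (\<lambda>_. x)"
  let ?h = "(mult_op x ^^ length v) (tree_value \<mu> (subt (ts ! i) v))"
  have "tree_eval \<mu> (\<lambda>q. ?g (j # q)) (ts ! j) = (replicate d x)[i := ?h] ! j" if "j < d" for j
  proof (cases "j = i")
    case True
    then show ?thesis
      using Cons.IH[OF child(3,2)] Cons.prems(3) child(1) by (simp add: Cons_in_sibling_positions)
  next
    case False
    then have "?g [j] = Some x" using Cons.prems(3) that by (simp add: Cons_in_sibling_positions)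
    then show ?thesis using False that by (simp add: tree_eval_Some)
  qed
  then have "child_values \<mu> ?g ts = (replicate d x)[i := ?h]"
    using child(4) by (intro nth_equalityI) simp_all
  then show ?case
    using mu_replicate_update[OF child(1)] by (simp add: T tree_eval_None Nil_notin_sibling_positions)
qed

lemma tree_eval_siblings_eq_0:
  assumes nilpotent: "\<And>x h. (mult_op x ^^ p) h = 0"
  assumes "is_catalan d T" "is_pos T v" "p \<le> length v"
  shows "tree_eval \<mu> (substitute (sibling_positions d p v) (\<lambda>_. x)) T = 0"
  using assms(2-)
proof (induction v arbitrary: T)
  case Nil
  then show ?case using tree_eval_siblings_along_path[of T "[]" p] nilpotent by simp
next
  case (Cons i v)
  show ?case
  proof (cases "p = Suc (length v)")
    case True
    then show ?thesis using tree_eval_siblings_along_path[OF Cons.prems(1,2), of p x] nilpotent by simp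
  next
    case False
    obtain ts where T: "T = Node ts" by (cases T)
    have child: "i < d" "is_pos (ts ! i) v" "is_catalan d (ts ! i)" "length ts = d"
      using Cons.prems by (auto simp: T is_catalan_Node)
    let ?g = "substitute (sibling_positions d p (i # v)) (\<lambda>_. x)"
    have "child_values \<mu> ?g ts ! i = 0"
      using Cons.IH[OF child(3,2)] Cons.prems(3) False child(1,4) by (simp add: Cons_in_sibling_positions)
    then have "0 \<in> set (child_values \<mu> ?g ts)"
      using nth_mem[of i "child_values \<mu> ?g ts"] child(1,4) by simp
    then show ?thesis
      using child(4) by (simp add: T tree_eval_None Nil_notin_sibling_positions mu_zero_in_set)
  qed
qed

lemma multi_additive_tree_eval:
  assumes \<phi>: "Modules.additive \<phi>" and T: "is_catalan d T" and S: "S \<subseteq> vertices T" "pairwise parallel S"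
  shows "multi_additive S (\<lambda>z. \<phi> (tree_eval \<mu> (substitute S z) T))"
  unfolding multi_additive_def
proof (intro allI ballI)
  fix z :: "nat list \<Rightarrow> 'v" and s assume s: "s \<in> S"
  have "substitute S (z(s := a)) = (substitute S z)(s \<mapsto> a)" for a using s by auto
  moreover have "Modules.additive (\<lambda>a. tree_eval \<mu> ((substitute S z)(s \<mapsto> a)) T)"
    using s S
    by (intro additive_tree_eval T) (auto simp: vertices_def pairwise_def dom_def split: if_splits)
  ultimately show "Modules.additive (\<lambda>a. \<phi> (tree_eval \<mu> (substitute S (z(s := a))) T))"
    using \<phi> by (simp add: Modules.additive_def del: fun_upd_apply)
qed

lemma sum_shuffle_class_eq_0:
  fixes \<phi> :: "'v \<Rightarrow> 'w::{idom, ring_char_0}"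
  assumes \<phi>: "Modules.additive \<phi>"
    and nilpotent: "\<And>x h. (mult_op x ^^ p) h = 0"
    and T: "is_catalan d T" and v: "v \<in> vertices T" "p \<le> length v"
  shows "(\<Sum>T'\<in>shuffle_class d T p v. \<phi> (tree_value \<mu> T')) = 0"
proof -
  define S where "S = sibling_positions d p v"
  define Q where "Q z = \<phi> (tree_eval \<mu> (substitute S z) T)" for z
  have fin: "finite S" by (simp add: S_def finite_sibling_positions)
  have Q_override: "Q (override_on z0 z S) = Q z" for z0 z
    unfolding Q_def by (intro arg_cong[where f = "\<lambda>g. \<phi> (tree_eval \<mu> g T)"]) auto
  have "multi_additive S Q"
    unfolding Q_def S_def
    by (intro multi_additive_tree_eval \<phi> T v sibling_positions_subset_vertices
        pairwise_parallel_sibling_positions)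
  moreover have "Q (\<lambda>_. x) = 0" for x
    using tree_eval_siblings_eq_0[OF nilpotent T _ v(2)] v(1) additive.zero[OF \<phi>]
    by (simp add: Q_def S_def vertices_def)
  ultimately have "0 = (\<Sum>\<sigma> | \<sigma> permutes S. Q ((\<lambda>q. tree_value \<mu> (subt T q)) \<circ> \<sigma>))"
    using sum_permutations_eq_0_of_diagonal[of S Q] fin by (simp add: Q_override)
  also have "\<dots> = (\<Sum>\<sigma> | \<sigma> permutes S. \<phi> (tree_value \<mu> (shuffled T S \<sigma>)))"
    by (simp add: Q_def tree_value_shuffled o_def)
  also have "\<dots> = of_nat (card (label_stabiliser (subt T) S))
      * (\<Sum>T'\<in>shuffle_class d T p v. \<phi> (tree_value \<mu> T'))"
    unfolding S_def by (rule sum_permutations_eq_sum_shuffle_class[OF T v(1)])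
  finally show ?thesis
    using card_label_stabiliser_pos[OF fin, of "subt T"] by simp
qed

definition tree_sum :: "nat \<Rightarrow> 'v" where
  "tree_sum k = (\<Sum>T\<in>catalan_trees d k. tree_value \<mu> T)"

lemma additive_tree_sum_eq_0:
  fixes \<phi> :: "'v \<Rightarrow> 'w::real_field"
  assumes \<phi>: "Modules.additive \<phi>"
    and nilpotent: "\<And>x h. (mult_op x ^^ p) h = 0"
    and P: "is_shuffle_family d p k P" "uniform_stationary d p k P"
  shows "\<phi> (tree_sum k) = 0"
proof -
  have "\<phi> (tree_sum k) = (\<Sum>T\<in>catalan_trees d k. \<phi> (tree_value \<mu> T))"
    unfolding tree_sum_def by (rule additive.sum[OF \<phi>])
  also have "\<dots> = 0"
    by (rule sum_catalan_trees_eq_0_if_shuffle_classes[OF d_pos P])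
      (auto simp: catalan_trees_alt intro: sum_shuffle_class_eq_0 \<phi> nilpotent)
  finally show ?thesis .
qed

lemma tree_sum_0: "tree_sum 0 = \<mu> []"
  by (simp add: tree_sum_def catalan_trees_0 tree_value_Node)

lemma tree_sum_Suc: "tree_sum (Suc k) = (\<Sum>ks | length ks = d \<and> sum_list ks = k. \<mu> (map tree_sum ks))"
proof -
  let ?K = "{ks. length ks = d \<and> sum_list ks = k}"
  let ?L = "\<lambda>ks. listset (map (catalan_trees d) ks)"
  have fin: "\<forall>B\<in>set (map (catalan_trees d) ks). finite B" for ks
    using finite_catalan_trees[OF d_pos] by auto
  have "tree_sum (Suc k) = (\<Sum>ts\<in>(\<Union>ks\<in>?K. ?L ks). tree_value \<mu> (Node ts))"
    unfolding tree_sum_def catalan_trees_Suc[OF d_pos]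
    by (subst sum.reindex) (simp_all add: inj_on_def)
  also have "\<dots> = (\<Sum>ks\<in>?K. \<Sum>ts\<in>?L ks. \<mu> (map (tree_value \<mu>) ts))"
    unfolding tree_value_Node
  proof (rule sum.UNION_disjoint[OF finite_compositions])
    show "\<forall>ks\<in>?K. finite (?L ks)" using finite_listset[OF fin] by blast
    show "\<forall>ks\<in>?K. \<forall>ks'\<in>?K. ks \<noteq> ks' \<longrightarrow> ?L ks \<inter> ?L ks' = {}"
      by (auto simp: in_listset_catalan_trees)
  qed
  also have "\<dots> = (\<Sum>ks\<in>?K. \<mu> (map tree_sum ks))"
  proof (intro sum.cong refl)
    fix ks assume "ks \<in> ?K"
    then show "(\<Sum>ts\<in>?L ks. \<mu> (map (tree_value \<mu>) ts)) = \<mu> (map tree_sum ks)"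
      using mu_listset[of "[]" "map (catalan_trees d) ks" "tree_value \<mu>"]
      by (simp add: o_def tree_sum_def[abs_def])
  qed
  finally show ?thesis .
qed

lemma mu_replicate_sum:
  "\<mu> (replicate d (\<Sum>b\<in>B. w b)) = (\<Sum>bs | length bs = d \<and> set bs \<subseteq> B. \<mu> (map w bs))"
proof -
  have "listset (replicate d B) = {bs. length bs = d \<and> set bs \<subseteq> B}"
    by (auto simp: in_listset_iff list_all2_conv_all_nth subset_code(1) all_set_conv_all_nth)
  then show ?thesis
    using mu_listset[of "[]" "replicate d B" w] by simp
qed

lemma tree_sum_Suc_bounded:
  assumes vanish: "\<And>k. K \<le> k \<Longrightarrow> tree_sum k = 0"
  shows "tree_sum (Suc k)
       = (\<Sum>ks | (length ks = d \<and> set ks \<subseteq> {..<K}) \<and> sum_list ks = k. \<mu> (map tree_sum ks))"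
  unfolding tree_sum_Suc
proof (rule sum.mono_neutral_right[OF finite_compositions], blast, rule ballI)
  fix ks
  assume "ks \<in> {ks. length ks = d \<and> sum_list ks = k}
    - {ks. (length ks = d \<and> set ks \<subseteq> {..<K}) \<and> sum_list ks = k}"
  then obtain k' where "length ks = d" "k' \<in> set ks" "K \<le> k'" by force
  then show "\<mu> (map tree_sum ks) = 0"
    using vanish[of k'] by (intro mu_zero_in_set) (auto simp: image_iff intro!: bexI[of _ k'])
qed

lemma tree_sum_fixed_point:
  assumes vanish: "\<And>k. K \<le> k \<Longrightarrow> tree_sum k = 0"
  defines "G \<equiv> \<Sum>k<K. tree_sum k"
  shows "G = \<mu> [] + \<mu> (replicate d G)"
proof -
  let ?L = "{ks. length ks = d \<and> set ks \<subseteq> {..<K}}"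
  have "sum_list ks \<le> d * K" if "ks \<in> ?L" for ks
    using sum_list_mono[of ks "\<lambda>k. k" "\<lambda>_. K"] that by (force simp: sum_list_triv)
  then have bound: "sum_list ` ?L \<subseteq> {..d * K + K}" by (force intro: trans_le_add1)
  have "finite ?L" using finite_lists_length_eq[of "{..<K}" d] by (simp add: conj_commute)
  have "\<mu> (replicate d G) = (\<Sum>ks\<in>?L. \<mu> (map tree_sum ks))"
    unfolding G_def by (rule mu_replicate_sum)
  also have "\<dots> = (\<Sum>k\<le>d * K + K. \<Sum>ks | ks \<in> ?L \<and> sum_list ks = k. \<mu> (map tree_sum ks))"
    by (rule sum.group[symmetric, OF \<open>finite ?L\<close> finite_atMost bound])
  also have "\<dots> = (\<Sum>k\<le>d * K + K. tree_sum (Suc k))"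
    by (simp add: tree_sum_Suc_bounded[OF vanish])
  also have "\<mu> [] + \<dots> = (\<Sum>k\<le>Suc (d * K + K). tree_sum k)"
    by (simp add: sum.atMost_Suc_shift tree_sum_0 del: sum.atMost_Suc)
  also have "\<dots> = G"
    unfolding G_def by (rule sum.mono_neutral_right) (auto simp: vanish)
  finally show ?thesis by simp
qed

end

section \<open>Polynomial functions of countably many variables\<close>

inductive poly_expr :: "((nat \<Rightarrow> 'a::comm_ring_1) \<Rightarrow> 'a) \<Rightarrow> bool" where
  const: "poly_expr (\<lambda>_. c)"
| var: "poly_expr (\<lambda>x. x i)"
| add: "poly_expr f \<Longrightarrow> poly_expr g \<Longrightarrow> poly_expr (\<lambda>x. f x + g x)"
| mult: "poly_expr f \<Longrightarrow> poly_expr g \<Longrightarrow> poly_expr (\<lambda>x. f x * g x)"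

lemma poly_expr_if: "poly_expr f \<Longrightarrow> poly_expr g \<Longrightarrow> poly_expr (\<lambda>x. if b then f x else g x)"
  by (cases b) simp_all

lemma poly_expr_sum: "(\<And>a. a \<in> A \<Longrightarrow> poly_expr (f a)) \<Longrightarrow> poly_expr (\<lambda>x. \<Sum>a\<in>A. f a x)"
  by (induction A rule: infinite_finite_induct) (auto intro: poly_expr.intros)

lemma poly_expr_prod: "(\<And>a. a \<in> A \<Longrightarrow> poly_expr (f a)) \<Longrightarrow> poly_expr (\<lambda>x. \<Prod>a\<in>A. f a x)"
  by (induction A rule: infinite_finite_induct) (auto intro: poly_expr.intros)

lemma poly_expr_compose:
  "poly_expr f \<Longrightarrow> (\<And>i. poly_expr (\<lambda>x. g x i)) \<Longrightarrow> poly_expr (\<lambda>x. f (g x))"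
  by (induction rule: poly_expr.induct) (auto intro: poly_expr.intros)

lemma poly_expr_along_poly_curve:
  assumes "poly_expr f"
  shows "\<exists>q. \<forall>s. f (\<lambda>i. poly (\<gamma> i) s) = poly q s"
  using assms
proof (induction rule: poly_expr.induct)
  case (const c)
  show ?case by (rule exI[of _ "[:c:]"]) simp
next
  case (var i)
  show ?case by blast
next
  case (add f g)
  then show ?case by (metis poly_add)
next
  case (mult f g)
  then show ?case by (metis poly_mult)
qed

section \<open>Polynomial maps given by lists of monomials\<close>

definition mon :: "(nat \<Rightarrow> 'a::comm_ring_1) \<Rightarrow> nat list \<Rightarrow> 'a" where
  "mon x vs = prod_list (map x vs)"

fun mon_deriv :: "(nat \<Rightarrow> 'a::comm_ring_1) \<Rightarrow> (nat \<Rightarrow> 'a) \<Rightarrow> nat list \<Rightarrow> 'a" where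
  "mon_deriv x h [] = 0"
| "mon_deriv x h (v # vs) = h v * mon x vs + x v * mon_deriv x h vs"

lemma mon_simps [simp]:
  "mon x [] = 1" "mon x (v # vs) = x v * mon x vs" "mon x (us @ vs) = mon x us * mon x vs"
  "mon x (replicate m v) = x v ^ m"
  by (simp_all add: mon_def)

lemma mon_deriv_append [simp]:
  "mon_deriv x h (us @ vs) = mon_deriv x h us * mon x vs + mon x us * mon_deriv x h vs"
  by (induction us) (simp_all add: algebra_simps)

lemma mon_deriv_replicate_zero [simp]: "h v = 0 \<Longrightarrow> mon_deriv x h (replicate m v) = 0"
  by (induction m) simp_all

lemma mon_cong: "(\<And>v. v \<in> set vs \<Longrightarrow> x v = y v) \<Longrightarrow> mon x vs = mon y vs"
  by (induction vs) simp_all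

lemma mon_deriv_cong:
  "(\<And>v. v \<in> set vs \<Longrightarrow> x v = y v) \<Longrightarrow> (\<And>v. v \<in> set vs \<Longrightarrow> h v = h' v)
    \<Longrightarrow> mon_deriv x h vs = mon_deriv y h' vs"
proof (induction vs)
  case (Cons v vs)
  then show ?case using mon_cong[of vs x y] by simp
qed simp

lemma mon_deriv_zero_direction: "(\<And>v. v \<in> set vs \<Longrightarrow> h v = 0) \<Longrightarrow> mon_deriv x h vs = 0"
  by (induction vs) simp_all

lemma mon_scale: "mon (\<lambda>i. r * x i) vs = r ^ length vs * mon x vs"
  by (induction vs) simp_all

lemma mon_deriv_scale: "mon_deriv (\<lambda>i. r * x i) h vs = r ^ (length vs - 1) * mon_deriv x h vs"
proof (induction vs)
  case (Cons v vs)
  have "r * x v * (r ^ (length vs - 1) * mon_deriv x h vs) = r ^ length vs * (x v * mon_deriv x h vs)"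
    by (cases vs) (simp_all add: mult_ac)
  then show ?case by (simp add: Cons mon_scale distrib_left mult.left_commute)
qed simp

lemma mon_zero: "vs \<noteq> [] \<Longrightarrow> mon (\<lambda>_. 0) vs = 0"
  by (cases vs) simp_all

lemma mon_deriv_zero: "length vs \<noteq> 1 \<Longrightarrow> mon_deriv (\<lambda>_. 0) h vs = 0"
  by (cases vs) (auto simp: mon_zero)

lemma poly_expr_mon: "poly_expr (\<lambda>x. mon x vs)"
  by (induction vs) (auto intro: poly_expr.intros)

text \<open>A term \<open>(c, vs, k)\<close> stands for \<open>c\<close> times the product of the variables listed in \<open>vs\<close>, placed
  in the \<open>k\<close>-th component. Values, derivatives and polarisations of a list of terms arise from
  different evaluations \<open>\<phi>\<close> of the monomials.\<close>
type_synonym 'a monomial_term = "'a \<times> nat list \<times> nat"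

definition terms_sum :: "'a::comm_ring_1 monomial_term list \<Rightarrow> (nat list \<Rightarrow> 'a) \<Rightarrow> nat \<Rightarrow> 'a" where
  "terms_sum L \<phi> i = (\<Sum>(c, vs, k)\<leftarrow>L. if k = i then c * \<phi> vs else 0)"

abbreviation terms_eval :: "'a::comm_ring_1 monomial_term list \<Rightarrow> (nat \<Rightarrow> 'a) \<Rightarrow> nat \<Rightarrow> 'a" where
  "terms_eval L x \<equiv> terms_sum L (mon x)"

abbreviation terms_deriv ::
  "'a::comm_ring_1 monomial_term list \<Rightarrow> (nat \<Rightarrow> 'a) \<Rightarrow> (nat \<Rightarrow> 'a) \<Rightarrow> nat \<Rightarrow> 'a" where
  "terms_deriv L x h \<equiv> terms_sum L (mon_deriv x h)"

definition perturbed_id :: "'a::comm_ring_1 monomial_term list \<Rightarrow> (nat \<Rightarrow> 'a) \<Rightarrow> nat \<Rightarrow> 'a" where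
  "perturbed_id L x i = x i + terms_eval L x i"

definition vars_below :: "nat \<Rightarrow> 'a monomial_term list \<Rightarrow> bool" where
  "vars_below N L \<longleftrightarrow> (\<forall>(c, vs, k)\<in>set L. k < N \<and> set vs \<subseteq> {..<N})"

definition degrees_in :: "nat set \<Rightarrow> 'a monomial_term list \<Rightarrow> bool" where
  "degrees_in D L \<longleftrightarrow> (\<forall>(c, vs, k)\<in>set L. length vs \<in> D)"

definition terms_of_degree :: "nat set \<Rightarrow> 'a monomial_term list \<Rightarrow> 'a monomial_term list" where
  "terms_of_degree D L = filter (\<lambda>(c, vs, k). length vs \<in> D) L"

definition nonsingular :: "'a::comm_ring_1 monomial_term list \<Rightarrow> bool" where
  "nonsingular L \<longleftrightarrow> (\<forall>x h. (\<forall>i. h i + terms_deriv L x h i = 0) \<longrightarrow> (\<forall>i. h i = 0))"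

definition poly_invertible :: "'a::comm_ring_1 monomial_term list \<Rightarrow> bool" where
  "poly_invertible L \<longleftrightarrow> (\<exists>G. (\<forall>i. poly_expr (\<lambda>x. G x i)) \<and>
     (\<forall>x. G (perturbed_id L x) = x) \<and> (\<forall>x. perturbed_id L (G x) = x))"

lemma monomial_terms_induct [case_names Nil Cons]:
  "P [] \<Longrightarrow> (\<And>c vs k L. P L \<Longrightarrow> P ((c, vs, k) # L)) \<Longrightarrow> P L"
  by (induction L) auto

lemma terms_sum_simps [simp]:
  "terms_sum [] \<phi> i = 0"
  "terms_sum ((c, vs, k) # L) \<phi> i = (if k = i then c * \<phi> vs else 0) + terms_sum L \<phi> i"
  "terms_sum (L @ L') \<phi> i = terms_sum L \<phi> i + terms_sum L' \<phi> i"
  by (simp_all add: terms_sum_def)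

lemma vars_below_simps [simp]:
  "vars_below N []"
  "vars_below N ((c, vs, k) # L) \<longleftrightarrow> k < N \<and> set vs \<subseteq> {..<N} \<and> vars_below N L"
  "vars_below N (L @ L') \<longleftrightarrow> vars_below N L \<and> vars_below N L'"
  by (simp_all add: vars_below_def ball_Un)

lemma degrees_in_simps [simp]:
  "degrees_in D []" "degrees_in D ((c, vs, k) # L) \<longleftrightarrow> length vs \<in> D \<and> degrees_in D L"
  "degrees_in D (L @ L') \<longleftrightarrow> degrees_in D L \<and> degrees_in D L'"
  by (simp_all add: degrees_in_def ball_Un)

lemma vars_below_mono: "vars_below N L \<Longrightarrow> N \<le> N' \<Longrightarrow> vars_below N' L"
  by (force simp: vars_below_def)

lemma degrees_in_mono: "degrees_in D L \<Longrightarrow> D \<subseteq> D' \<Longrightarrow> degrees_in D' L"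
  by (force simp: degrees_in_def)

lemma vars_below_terms_of_degree: "vars_below N L \<Longrightarrow> vars_below N (terms_of_degree D L)"
  by (auto simp: vars_below_def terms_of_degree_def)

lemma degrees_in_terms_of_degree: "degrees_in D (terms_of_degree D L)"
  by (auto simp: degrees_in_def terms_of_degree_def)

lemma terms_of_degree_eq_self: "degrees_in D L \<Longrightarrow> terms_of_degree D L = L"
  by (auto simp: degrees_in_def terms_of_degree_def intro: filter_True)

lemma terms_sum_degree_Un:
  assumes "D \<inter> D' = {}"
  shows "terms_sum (terms_of_degree (D \<union> D') L) \<phi> i
       = terms_sum (terms_of_degree D L) \<phi> i + terms_sum (terms_of_degree D' L) \<phi> i"
  using assms by (induction L rule: monomial_terms_induct) (auto simp: terms_of_degree_def)

lemma terms_sum_cong: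
  assumes "\<And>c vs k. (c, vs, k) \<in> set L \<Longrightarrow> \<phi> vs = \<psi> vs"
  shows "terms_sum L \<phi> i = terms_sum L \<psi> i"
  unfolding terms_sum_def using assms by (intro arg_cong[where f = sum_list] map_cong refl) auto

lemma terms_sum_eq_0:
  assumes "\<And>c vs k. (c, vs, k) \<in> set L \<Longrightarrow> k = i \<Longrightarrow> \<phi> vs = 0"
  shows "terms_sum L \<phi> i = 0"
proof -
  have "terms_sum L \<phi> i = (\<Sum>_\<leftarrow>L. 0)"
    unfolding terms_sum_def using assms by (intro arg_cong[where f = sum_list] map_cong refl) auto
  then show ?thesis by simp
qed

lemma terms_sum_outside: "vars_below N L \<Longrightarrow> N \<le> i \<Longrightarrow> terms_sum L \<phi> i = 0"
  by (rule terms_sum_eq_0) (auto simp: vars_below_def)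

lemma terms_sum_mult: "terms_sum L (\<lambda>vs. r * \<phi> vs) i = r * terms_sum L \<phi> i"
  by (induction L rule: monomial_terms_induct) (auto simp: algebra_simps)

lemma terms_sum_add: "terms_sum L (\<lambda>vs. \<phi> vs + \<psi> vs) i = terms_sum L \<phi> i + terms_sum L \<psi> i"
  by (induction L rule: monomial_terms_induct) (auto simp: algebra_simps)

lemma poly_expr_terms_sum:
  assumes "\<And>c vs k. (c, vs, k) \<in> set L \<Longrightarrow> poly_expr (\<lambda>x. \<phi> x vs)"
  shows "poly_expr (\<lambda>x. terms_sum L (\<phi> x) i)"
  using assms
  by (induction L rule: monomial_terms_induct) (auto intro!: poly_expr.intros poly_expr_if)

lemma poly_expr_perturbed_id: "poly_expr (\<lambda>x. perturbed_id L x i)"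
  unfolding perturbed_id_def by (intro poly_expr.intros poly_expr_terms_sum poly_expr_mon)

lemma terms_eval_cong:
  assumes "vars_below N L" "\<And>j. j < N \<Longrightarrow> x j = y j"
  shows "terms_eval L x i = terms_eval L y i"
  using assms by (intro terms_sum_cong mon_cong) (force simp: vars_below_def)

lemma terms_deriv_cong:
  assumes "vars_below N L" "\<And>j. j < N \<Longrightarrow> x j = y j" "\<And>j. j < N \<Longrightarrow> h j = h' j"
  shows "terms_deriv L x h i = terms_deriv L y h' i"
  using assms by (intro terms_sum_cong mon_deriv_cong) (force simp: vars_below_def)+

lemma terms_deriv_zero_direction:
  assumes "vars_below N L" "\<And>j. j < N \<Longrightarrow> h j = 0"
  shows "terms_deriv L x h i = 0"
  using assms by (intro terms_sum_eq_0 mon_deriv_zero_direction) (force simp: vars_below_def)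

lemma terms_deriv_scale:
  assumes "degrees_in {m} L"
  shows "terms_deriv L (\<lambda>i. r * x i) h i = r ^ (m - 1) * terms_deriv L x h i"
  unfolding terms_sum_mult[symmetric] using assms
  by (intro terms_sum_cong) (auto simp: mon_deriv_scale degrees_in_def)

lemma nonsingularD:
  assumes "nonsingular L" "vars_below N L" "\<And>i. i < N \<Longrightarrow> h i + terms_deriv L x h i = 0" "i < N"
  shows "h i = 0"
proof -
  let ?h = "\<lambda>i. if i < N then h i else 0"
  have "?h i + terms_deriv L x ?h i = 0" for i
    using assms(3)[of i] terms_deriv_cong[OF assms(2), of x x ?h h i]
      terms_sum_outside[OF assms(2), of i "mon_deriv x ?h"]
    by (cases "i < N") auto
  then have "\<forall>i. ?h i = 0" using assms(1)[unfolded nonsingular_def, rule_format, of ?h x] by blast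
  then show ?thesis using assms(4) by (metis (full_types))
qed

text \<open>\<open>\<theta>\<close> embeds the graph of \<open>perturbed_id L\<close> into that of a map in more variables, compatibly
  with the embedding \<open>\<iota>\<close> of the target.\<close>
lemma poly_invertible_stabilise:
  assumes inv: "poly_invertible L'" and below: "vars_below N L"
    and \<iota>: "\<And>i. poly_expr (\<lambda>u. \<iota> u i)"
    and \<theta>: "\<And>x i. i < N \<Longrightarrow> \<theta> x i = x i"
    and graph: "\<And>x. perturbed_id L' (\<theta> x) = \<iota> (perturbed_id L x)"
    and recover: "\<And>w u i. perturbed_id L' w = \<iota> u \<Longrightarrow> i < N \<Longrightarrow> perturbed_id L w i = u i"
  shows "poly_invertible L"
proof -
  obtain G' where inverse: "\<And>i. poly_expr (\<lambda>x. G' x i)" "\<And>x. G' (perturbed_id L' x) = x"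
      "\<And>x. perturbed_id L' (G' x) = x"
    using inv unfolding poly_invertible_def by blast
  define G where "G u i = (if i < N then G' (\<iota> u) i else u i)" for u i
  have "poly_expr (\<lambda>u. G u i)" for i
    unfolding G_def by (intro poly_expr_if poly_expr_compose[OF inverse(1)] \<iota> poly_expr.var)
  moreover have "G (perturbed_id L x) = x" for x
  proof
    fix i
    show "G (perturbed_id L x) i = x i"
      using \<theta>[of i x] terms_sum_outside[OF below, of i "mon x"]
      by (simp add: G_def graph[symmetric] inverse(2)) (simp add: perturbed_id_def)
  qed
  moreover have "perturbed_id L (G u) = u" for u
  proof
    fix i
    show "perturbed_id L (G u) i = u i"
    proof (cases "i < N")
      case True
      have "terms_eval L (G u) i = terms_eval L (G' (\<iota> u)) i"
        by (rule terms_eval_cong[OF below]) (simp add: G_def)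
      then have "perturbed_id L (G u) i = perturbed_id L (G' (\<iota> u)) i"
        using True by (simp add: perturbed_id_def G_def)
      then show ?thesis using recover[OF inverse(3) True] by simp
    next
      case False
      then show ?thesis using terms_sum_outside[OF below] by (simp add: perturbed_id_def G_def)
    qed
  qed
  ultimately show ?thesis unfolding poly_invertible_def by blast
qed

section \<open>Right inverses are left inverses\<close>

lemma dvd_mon: "(\<And>v. v \<in> set vs \<Longrightarrow> t dvd a v) \<Longrightarrow> vs \<noteq> [] \<Longrightarrow> t dvd mon a vs"
  by (cases vs) auto

lemma dvd_mon_diff:
  assumes "\<And>v. v \<in> set vs \<Longrightarrow> u dvd a v - b v"
  shows "u dvd mon a vs - mon b vs"
  using assms
proof (induction vs)
  case (Cons v vs)
  have "mon a (v # vs) - mon b (v # vs) = (a v - b v) * mon a vs + b v * (mon a vs - mon b vs)"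
    by (simp add: algebra_simps)
  then show ?case using Cons by simp
qed simp

lemma power_Suc_dvd_mon_diff:
  assumes "\<And>v. v \<in> set vs \<Longrightarrow> t dvd a v" "\<And>v. v \<in> set vs \<Longrightarrow> t dvd b v"
    "\<And>v. v \<in> set vs \<Longrightarrow> t ^ m dvd a v - b v" "2 \<le> length vs"
  shows "t ^ Suc m dvd mon a vs - mon b vs"
proof -
  obtain v us where vs: "vs = v # us" and "us \<noteq> []" using assms(4) by (cases vs) force+
  have "mon a vs - mon b vs = mon a us * (a v - b v) + b v * (mon a us - mon b us)"
    by (simp add: vs algebra_simps)
  moreover have "t dvd mon a us" "t ^ m dvd mon a us - mon b us"
    using assms \<open>us \<noteq> []\<close> by (auto simp: vs intro: dvd_mon dvd_mon_diff)
  ultimately show ?thesis using assms by (simp add: vs mult_dvd_mono)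
qed

lemma power_dvd_diff_if_perturbed_id_eq:
  assumes degrees: "degrees_in {2..} L" and same_image: "perturbed_id L a = perturbed_id L b"
    and vanishing: "\<And>v. t dvd a v" "\<And>v. t dvd b v"
  shows "t ^ m dvd a v - b v"
proof (induction m arbitrary: v)
  case (Suc m)
  have "t ^ Suc m dvd terms_eval L a v - terms_eval L b v"
    using degrees
  proof (induction L rule: monomial_terms_induct)
    case (Cons c vs k L)
    then have "t ^ Suc m dvd mon a vs - mon b vs"
      using vanishing Suc.IH by (intro power_Suc_dvd_mon_diff) auto
    moreover have "terms_eval ((c, vs, k) # L) a v - terms_eval ((c, vs, k) # L) b v
        = (if k = v then c * (mon a vs - mon b vs) else 0) + (terms_eval L a v - terms_eval L b v)"
      by (simp add: algebra_simps)
    ultimately show ?case using Cons by (auto simp del: terms_sum_simps intro!: dvd_add dvd_mult)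
  qed simp
  moreover have "a v - b v = - (terms_eval L a v - terms_eval L b v)"
    using fun_cong[OF same_image, of v] by (simp add: perturbed_id_def algebra_simps)
  ultimately show ?case by (simp only: dvd_minus_iff)
qed simp

lemma poly_eq_0_if_X_powers_dvd:
  fixes p :: "'a::idom poly"
  assumes "\<And>m. [:0, 1:] ^ m dvd p"
  shows "p = 0"
proof (rule ccontr)
  assume "p \<noteq> 0"
  then have "degree ([:0, 1:] ^ Suc (degree p) :: 'a poly) \<le> degree p"
    using assms by (intro dvd_imp_degree_le)
  then show False by (simp only: degree_linear_power)
qed

definition lift_terms :: "'a::comm_ring_1 monomial_term list \<Rightarrow> 'a poly monomial_term list" where
  "lift_terms L = map (\<lambda>(c, vs, k). ([:c:], vs, k)) L"

lemma poly_terms_eval_lift: "poly (terms_eval (lift_terms L) q i) s = terms_eval L (\<lambda>j. poly (q j) s) i"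
proof (induction L rule: monomial_terms_induct)
  case (Cons c vs k L)
  have "poly (mon q vs) s = mon (\<lambda>j. poly (q j) s) vs"
    by (induction vs) simp_all
  then show ?case using Cons by (simp add: lift_terms_def)
qed (simp add: lift_terms_def)

text \<open>Along the line \<open>s \<mapsto> s x\<close> both \<open>s x\<close> and \<open>G (F (s x))\<close> are preimages of \<open>F (s x)\<close> which are
  polynomial in \<open>s\<close> and vanish at \<open>0\<close>; their difference is divisible by every power of \<open>s\<close>.\<close>
lemma right_inverse_imp_left_inverse:
  fixes L :: "'a::{idom, ring_char_0} monomial_term list"
  assumes degrees: "degrees_in {2..} L"
    and poly: "\<And>i. poly_expr (\<lambda>y. G y i)"
    and right_inverse: "\<And>y. perturbed_id L (G y) = y" and zero: "G (\<lambda>_. 0) = (\<lambda>_. 0)"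
  shows "G (perturbed_id L x) = x"
proof -
  define line where "line i = [:0, x i:]" for i
  have poly_perturbed_id:
    "poly (perturbed_id (lift_terms L) q i) s = perturbed_id L (\<lambda>j. poly (q j) s) i" for q i s
    by (simp add: perturbed_id_def poly_terms_eval_lift)
  have "poly_expr (\<lambda>z. G (perturbed_id L z) i)" for i
    using poly poly_expr_perturbed_id by (rule poly_expr_compose)
  then have "\<exists>q. \<forall>s. G (perturbed_id L (\<lambda>j. poly (line j) s)) i = poly q s" for i
    by (rule poly_expr_along_poly_curve)
  then obtain q where q_eq: "\<And>i s. G (perturbed_id L (\<lambda>j. poly (line j) s)) i = poly (q i) s"
    by metis
  have "perturbed_id (lift_terms L) q = perturbed_id (lift_terms L) line"
  proof (rule ext, rule poly_ext)
    fix i s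
    show "poly (perturbed_id (lift_terms L) q i) s = poly (perturbed_id (lift_terms L) line i) s"
      unfolding poly_perturbed_id q_eq[symmetric] right_inverse ..
  qed
  moreover have "degrees_in {2..} (lift_terms L)"
    using degrees by (auto simp: lift_terms_def degrees_in_def)
  moreover have "[:0, 1:] dvd line i" for i by (simp add: line_def dvd_iff_poly_eq_0)
  moreover have "[:0, 1:] dvd q i" for i
  proof -
    have "terms_eval L (\<lambda>_. 0) j = 0" for j
      using degrees by (intro terms_sum_eq_0 mon_zero) (force simp: degrees_in_def)
    then have "perturbed_id L (\<lambda>_. 0) = (\<lambda>_. 0)" by (simp add: perturbed_id_def fun_eq_iff)
    then have "poly (q i) 0 = 0" using q_eq[of 0 i] zero by (simp add: line_def)
    then show ?thesis by (simp add: dvd_iff_poly_eq_0)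
  qed
  ultimately have "[:0, 1:] ^ m dvd q i - line i" for m i
    by (intro power_dvd_diff_if_perturbed_id_eq)
  then have "q i - line i = 0" for i by (rule poly_eq_0_if_X_powers_dvd)
  then show ?thesis using q_eq[of 1] by (simp add: line_def fun_eq_iff)
qed

section \<open>Reduction of the degree\<close>

definition excess :: "'a monomial_term list \<Rightarrow> nat" where
  "excess L = (\<Sum>(c, vs, k)\<leftarrow>L. if length vs \<le> 3 then 0 else 3 ^ length vs)"

text \<open>With two new variables \<open>y\<close>, \<open>z\<close>, the monomial \<open>c a b\<close> in component \<open>k\<close> is traded for
  monomials of lower degree by adding \<open>c a\<close> to \<open>y\<close> and \<open>b\<close> to \<open>z\<close> and then subtracting \<open>y z\<close> from
  component \<open>k\<close>.\<close>
definition split_terms ::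
  "nat \<Rightarrow> 'a::comm_ring_1 \<Rightarrow> nat list \<Rightarrow> nat list \<Rightarrow> nat \<Rightarrow> 'a monomial_term list" where
  "split_terms N c as bs k =
     [(c, as, N), (1, bs, Suc N), (-1, [N, Suc N], k), (-1, N # bs, k), (- c, Suc N # as, k)]"

context
  fixes N :: nat and c :: "'a::comm_ring_1" and as bs :: "nat list" and k :: nat
    and L1 L2 L L_split :: "'a monomial_term list"
  defines "L \<equiv> L1 @ (c, as @ bs, k) # L2"
  defines "L_split \<equiv> L1 @ L2 @ split_terms N c as bs k"
  assumes below: "vars_below N L"
begin

private lemma below_parts:
  "k < N" "set as \<subseteq> {..<N}" "set bs \<subseteq> {..<N}" "vars_below N L1" "vars_below N L2"
  using below by (auto simp: L_def)

private lemma perturbed_id_split: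
  "perturbed_id L_split x i =
    (if i = N then x N + c * mon x as
     else if i = Suc N then x (Suc N) + mon x bs
     else if i = k then perturbed_id L x k - (x N + c * mon x as) * (x (Suc N) + mon x bs)
     else perturbed_id L x i)"
  using below_parts terms_sum_outside[OF below_parts(4)] terms_sum_outside[OF below_parts(5)]
  by (auto simp: perturbed_id_def L_split_def L_def split_terms_def algebra_simps)

private lemma terms_deriv_split:
  "h i + terms_deriv L_split x h i =
    (if i = N then h N + c * mon_deriv x h as
     else if i = Suc N then h (Suc N) + mon_deriv x h bs
     else if i = k then h k + terms_deriv L x h k
       - (h N + c * mon_deriv x h as) * (x (Suc N) + mon x bs)
       - (x N + c * mon x as) * (h (Suc N) + mon_deriv x h bs)
     else h i + terms_deriv L x h i)"
  using below_parts terms_sum_outside[OF below_parts(4)] terms_sum_outside[OF below_parts(5)]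
  by (auto simp: L_split_def L_def split_terms_def algebra_simps)

lemma vars_below_split: "vars_below (Suc (Suc N)) L_split"
  using below_parts vars_below_mono[OF below_parts(4), of "Suc (Suc N)"]
    vars_below_mono[OF below_parts(5), of "Suc (Suc N)"]
  by (auto simp: L_split_def split_terms_def)

lemma nonsingular_split:
  assumes "nonsingular L"
  shows "nonsingular L_split"
  unfolding nonsingular_def
proof (intro allI impI)
  fix x h i
  assume "\<forall>i. h i + terms_deriv L_split x h i = 0"
  then have kernel: "h i + terms_deriv L_split x h i = 0" for i by blast
  have new: "h N + c * mon_deriv x h as = 0" "h (Suc N) + mon_deriv x h bs = 0"
    using kernel[of N] kernel[of "Suc N"] by (simp_all add: terms_deriv_split)
  then have "h i + terms_deriv L x h i = 0" if "i < N" for i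
    using kernel[of i] that by (cases "i = k") (simp_all add: terms_deriv_split)
  then have old_zero: "h i = 0" if "i < N" for i
    using nonsingularD[OF assms below _ that] by blast
  then have "mon_deriv x h as = 0" "mon_deriv x h bs = 0"
    using below_parts by (auto intro!: mon_deriv_zero_direction)
  then have "h N = 0" "h (Suc N) = 0" using new by auto
  moreover have "h i = 0" if "Suc N < i"
    using kernel[of i] that terms_sum_outside[OF vars_below_split, of i "mon_deriv x h"] by simp
  ultimately show "h i = 0" using old_zero by (cases "i < N"; cases "i = N"; cases "i = Suc N") auto
qed

lemma poly_invertible_split:
  assumes "poly_invertible L_split"
  shows "poly_invertible L"
proof (rule poly_invertible_stabilise[OF assms below])
  let ?\<theta> = "\<lambda>x. x(N := - c * mon x as, Suc N := - mon x bs)"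
  let ?\<iota> = "\<lambda>u. u(N := 0, Suc N := 0)"
  show "poly_expr (\<lambda>u. ?\<iota> u i)" for i
    by (cases "i = N"; cases "i = Suc N") (simp_all add: poly_expr.intros)
  show "?\<theta> x i = x i" if "i < N" for x i using that by simp
  show "perturbed_id L_split (?\<theta> x) = ?\<iota> (perturbed_id L x)" for x
  proof
    fix i
    have factors: "mon (?\<theta> x) as = mon x as" "mon (?\<theta> x) bs = mon x bs"
      using below_parts by (auto intro!: mon_cong)
    have "terms_eval L (?\<theta> x) i = terms_eval L x i" for i by (rule terms_eval_cong[OF below]) simp
    then have "perturbed_id L (?\<theta> x) i = perturbed_id L x i" if "i \<noteq> N" "i \<noteq> Suc N" for i
      using that by (simp add: perturbed_id_def)
    then show "perturbed_id L_split (?\<theta> x) i = ?\<iota> (perturbed_id L x) i"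
      unfolding perturbed_id_split factors using below_parts(1) by auto
  qed
  fix w u i assume image: "perturbed_id L_split w = ?\<iota> u" and "i < N"
  have "w N + c * mon w as = 0" using fun_cong[OF image, of N] by (simp add: perturbed_id_split)
  then show "perturbed_id L w i = u i"
    using fun_cong[OF image, of i] \<open>i < N\<close> by (auto simp: perturbed_id_split split: if_splits)
qed

lemma excess_split:
  assumes "length as = 2" "2 \<le> length bs"
  shows "excess L_split < excess L"
proof -
  obtain m where m: "length bs = Suc (Suc m)" using assms(2) by (metis add_2_eq_Suc le_Suc_ex)
  show ?thesis using assms(1) by (simp add: excess_def L_split_def L_def split_terms_def m)
qed

lemma degrees_in_split:
  assumes "degrees_in {2..} L" "length as = 2" "2 \<le> length bs"
  shows "degrees_in {2..} L_split"
  using assms by (simp add: L_def L_split_def split_terms_def)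

end

lemma reduce_to_cubic:
  fixes L :: "'a::comm_ring_1 monomial_term list"
  assumes cubic: "\<And>N (L :: 'a monomial_term list).
      vars_below N L \<Longrightarrow> degrees_in {2, 3} L \<Longrightarrow> nonsingular L \<Longrightarrow> poly_invertible L"
    and "vars_below N L" "degrees_in {2..} L" "nonsingular L"
  shows "poly_invertible L"
  using assms(2-)
proof (induction "excess L" arbitrary: N L rule: less_induct)
  case less
  show ?case
  proof (cases "degrees_in {2, 3} L")
    case True
    then show ?thesis using cubic less.prems by blast
  next
    case False
    then obtain c vs k where "(c, vs, k) \<in> set L" "length vs \<notin> {2, 3}" by (auto simp: degrees_in_def)
    moreover from this have "4 \<le> length vs" using less.prems(2) by (force simp: degrees_in_def)
    ultimately obtain L1 L2 where "L = L1 @ (c, vs, k) # L2" by (meson split_list)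
    moreover define as bs where "as = take 2 vs" and "bs = drop 2 vs"
    ultimately have L_split: "L = L1 @ (c, as @ bs, k) # L2" by simp
    have lengths: "length as = 2" "2 \<le> length bs" using \<open>4 \<le> length vs\<close> by (auto simp: as_def bs_def)
    note prems = less.prems[unfolded L_split]
    have "poly_invertible (L1 @ L2 @ split_terms N c as bs k)"
      using excess_split[OF prems(1) lengths] vars_below_split[OF prems(1)]
        degrees_in_split[OF prems(1,2) lengths] nonsingular_split[OF prems(1,3)]
      unfolding L_split[symmetric] by (rule less.hyps)
    then show ?thesis unfolding L_split by (rule poly_invertible_split[OF prems(1)])
  qed
qed

section \<open>Homogenisation\<close>

text \<open>For \<open>x + Q(x) + C(x)\<close> with \<open>Q\<close> quadratic and \<open>C\<close> cubic, this is the map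
  \<open>(x, y, t) \<mapsto> (x + t^(d-2) Q(x) - t^(d-1) y, y + t^(d-3) C(x), t)\<close>.\<close>
definition homogenise :: "nat \<Rightarrow> nat \<Rightarrow> 'a::comm_ring_1 monomial_term list \<Rightarrow> 'a monomial_term list" where
  "homogenise d N L =
     map (\<lambda>(c, vs, k). (c, replicate (d - 2) (2 * N) @ vs, k)) (terms_of_degree {2} L) @
     map (\<lambda>(c, vs, k). (c, replicate (d - 3) (2 * N) @ vs, N + k)) (terms_of_degree {3} L) @
     map (\<lambda>k. (-1, replicate (d - 1) (2 * N) @ [N + k], k)) [0..<N]"

lemma degrees_in_homogenise: "3 \<le> d \<Longrightarrow> degrees_in {d} (homogenise d N L)"
  by (auto simp: homogenise_def degrees_in_def terms_of_degree_def)

lemma vars_below_homogenise: "vars_below N L \<Longrightarrow> vars_below (Suc (2 * N)) (homogenise d N L)"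
  by (auto 0 3 simp: homogenise_def vars_below_def terms_of_degree_def)

lemma terms_sum_homogenise_top:
  assumes "vars_below N L" "2 * N \<le> i"
  shows "terms_sum (homogenise d N L) \<phi> i = 0"
  using assms by (intro terms_sum_eq_0) (force simp: homogenise_def vars_below_def terms_of_degree_def)

lemma terms_sum_map_prefix:
  assumes "\<And>vs. \<phi> (us @ vs) = r * \<phi> vs" "inj f"
  shows "terms_sum (map (\<lambda>(c, vs, k). (c, us @ vs, f k)) L) \<phi> (f i) = r * terms_sum L \<phi> i"
  using assms
  by (induction L rule: monomial_terms_induct) (auto simp: algebra_simps inj_eq)

lemma terms_sum_map_upt:
  "terms_sum (map (\<lambda>k. (c k, us k, k)) [0..<N]) \<phi> i = (if i < N then c i * \<phi> (us i) else 0)"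
  by (induction N) auto

context
  fixes d N :: nat and L :: "'a::comm_ring_1 monomial_term list"
    and \<phi> :: "nat list \<Rightarrow> 'a" and r :: 'a
  assumes below: "vars_below N L"
    and prefix: "\<And>m vs. \<phi> (replicate m (2 * N) @ vs) = r ^ m * \<phi> vs"
begin

lemma terms_sum_homogenise_low:
  assumes "i < N"
  shows "terms_sum (homogenise d N L) \<phi> i
    = r ^ (d - 2) * terms_sum (terms_of_degree {2} L) \<phi> i - r ^ (d - 1) * \<phi> [N + i]"
proof -
  have "terms_sum (map (\<lambda>(c, vs, k). (c, replicate (d - 3) (2 * N) @ vs, N + k))
      (terms_of_degree {3} L)) \<phi> i = 0"
    using assms by (intro terms_sum_eq_0) auto
  then show ?thesis
    using assms
      terms_sum_map_prefix[of \<phi> "replicate (d - 2) (2 * N)" "r ^ (d - 2)" "\<lambda>k. k" "terms_of_degree {2} L" i]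
    by (simp add: homogenise_def terms_sum_map_upt prefix)
qed

lemma terms_sum_homogenise_mid:
  "terms_sum (homogenise d N L) \<phi> (N + i) = r ^ (d - 3) * terms_sum (terms_of_degree {3} L) \<phi> i"
proof -
  have "terms_sum (map (\<lambda>(c, vs, k). (c, replicate (d - 2) (2 * N) @ vs, k))
      (terms_of_degree {2} L)) \<phi> (N + i) = 0"
    using below by (intro terms_sum_eq_0) (force simp: terms_of_degree_def vars_below_def)
  then show ?thesis
    using
      terms_sum_map_prefix[of \<phi> "replicate (d - 3) (2 * N)" "r ^ (d - 3)" "(+) N" "terms_of_degree {3} L" i]
    by (simp add: homogenise_def terms_sum_map_upt prefix)
qed

end

lemma terms_sum_quadratic_cubic:
  assumes "degrees_in {2, 3} L"
  shows "terms_sum L \<phi> i = terms_sum (terms_of_degree {2} L) \<phi> i + terms_sum (terms_of_degree {3} L) \<phi> i"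
  using terms_sum_degree_Un[of "{2}" "{3}" L \<phi> i] terms_of_degree_eq_self[OF assms]
  by (simp add: insert_commute)

lemma nonsingular_homogenise:
  fixes L :: "'a::comm_ring_1 monomial_term list"
  assumes d: "3 \<le> d" and below: "vars_below N L" and degrees: "degrees_in {2, 3} L"
    and nonsing: "nonsingular L"
  shows "nonsingular (homogenise d N L)"
  unfolding nonsingular_def
proof (intro allI impI)
  fix x h :: "nat \<Rightarrow> 'a" and i
  assume "\<forall>i. h i + terms_deriv (homogenise d N L) x h i = 0"
  then have kernel: "h i + terms_deriv (homogenise d N L) x h i = 0" for i by blast
  let ?Q = "terms_of_degree {2} L" and ?C = "terms_of_degree {3} L" and ?t = "x (2 * N)"
  have top: "h i = 0" if "2 * N \<le> i" for i
    using kernel[of i] that by (simp add: terms_sum_homogenise_top[OF below])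
  then have prefix: "mon_deriv x h (replicate m (2 * N) @ vs) = ?t ^ m * mon_deriv x h vs" for m vs
    by simp
  have mid: "h (N + i) = - (?t ^ (d - 3) * terms_deriv ?C x h i)" for i
    using kernel[of "N + i"]
    by (simp add: terms_sum_homogenise_mid[OF below prefix] eq_neg_iff_add_eq_0)
  have "d - 1 + (d - 3) = (d - 2) + (d - 2)" using d by simp
  then have powers: "?t ^ (d - 1) * ?t ^ (d - 3) = ?t ^ (d - 2) * ?t ^ (d - 2)"
    by (simp only: power_add[symmetric])
  have low: "h i = 0" if "i < N" for i
  proof (rule nonsingularD[OF nonsing below _ that])
    fix i assume "i < N"
    have "h i + (?t ^ (d - 2) * terms_deriv ?Q x h i
        + ?t ^ (d - 1) * ?t ^ (d - 3) * terms_deriv ?C x h i) = 0"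
      using kernel[of i] by (simp add: terms_sum_homogenise_low[OF below prefix \<open>i < N\<close>] mid mult.assoc)
    then show "h i + terms_deriv L (\<lambda>i. ?t ^ (d - 2) * x i) h i = 0"
      unfolding powers
      by (simp add: terms_sum_quadratic_cubic[OF degrees] power2_eq_square
          terms_deriv_scale[OF degrees_in_terms_of_degree])
  qed
  have "h (N + i) = 0" for i
    using mid terms_deriv_zero_direction[OF vars_below_terms_of_degree[OF below] low] by simp
  then show "h i = 0" using low by (metis le_Suc_ex not_less)
qed

lemma
  assumes below: "vars_below N L" and t: "w (2 * N) = 1"
  shows perturbed_id_homogenise_low:
      "i < N \<Longrightarrow>
        perturbed_id (homogenise d N L) w i = w i + terms_eval (terms_of_degree {2} L) w i - w (N + i)"
    and perturbed_id_homogenise_mid: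
      "perturbed_id (homogenise d N L) w (N + i) = w (N + i) + terms_eval (terms_of_degree {3} L) w i"
  using t terms_sum_homogenise_low[OF below, of "mon w" 1 i d]
    terms_sum_homogenise_mid[OF below, of "mon w" 1 d i]
  by (simp_all add: perturbed_id_def)

lemma perturbed_id_homogenise_top:
  "vars_below N L \<Longrightarrow> 2 * N \<le> i \<Longrightarrow> perturbed_id (homogenise d N L) w i = w i"
  by (simp add: perturbed_id_def terms_sum_homogenise_top)

definition homogenise_target :: "nat \<Rightarrow> (nat \<Rightarrow> 'a::comm_ring_1) \<Rightarrow> nat \<Rightarrow> 'a" where
  "homogenise_target N u i =
     (if i < N then u i else if i < 2 * N then 0 else if i = 2 * N then 1 else u i)"

definition homogenise_graph :: "nat \<Rightarrow> 'a::comm_ring_1 monomial_term list \<Rightarrow> (nat \<Rightarrow> 'a) \<Rightarrow> nat \<Rightarrow> 'a" where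
  "homogenise_graph N L x i =
     (if i < N then x i else if i < 2 * N then - terms_eval (terms_of_degree {3} L) x (i - N)
      else if i = 2 * N then 1 else x i)"

lemma perturbed_id_homogenise_graph:
  assumes below: "vars_below N L" and degrees: "degrees_in {2, 3} L"
  shows "perturbed_id (homogenise d N L) (homogenise_graph N L x)
       = homogenise_target N (perturbed_id L x)"
proof
  fix i
  let ?w = "homogenise_graph N L x"
  have t: "?w (2 * N) = 1" by (simp add: homogenise_graph_def)
  have graph_low: "terms_eval (terms_of_degree D L) ?w i = terms_eval (terms_of_degree D L) x i" for D i
    by (rule terms_eval_cong[OF vars_below_terms_of_degree[OF below]]) (simp add: homogenise_graph_def)
  consider (low) "i < N" | (mid) j where "i = N + j" "j < N" | (top) "2 * N \<le> i"
    by (metis add_less_cancel_left le_Suc_ex mult_2 not_less)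
  then show "perturbed_id (homogenise d N L) ?w i = homogenise_target N (perturbed_id L x) i"
  proof cases
    case low
    then show ?thesis
      using perturbed_id_homogenise_low[of N L ?w, OF below t low, of d] graph_low
      by (simp add: homogenise_graph_def homogenise_target_def perturbed_id_def
          terms_sum_quadratic_cubic[OF degrees])
  next
    case mid
    then show ?thesis
      using perturbed_id_homogenise_mid[of N L ?w, OF below t, of d j] graph_low
      by (simp add: homogenise_graph_def homogenise_target_def)
  next
    case top
    then show ?thesis
      using perturbed_id_homogenise_top[OF below top, of d ?w] terms_sum_outside[OF below]
      by (simp add: homogenise_graph_def homogenise_target_def perturbed_id_def)
  qed
qed

lemma poly_invertible_homogenise:
  assumes below: "vars_below N L" and degrees: "degrees_in {2, 3} L"
    and inv: "poly_invertible (homogenise d N L)"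
  shows "poly_invertible L"
proof (rule poly_invertible_stabilise[OF inv below])
  show "poly_expr (\<lambda>u. homogenise_target N u i)" for i
    unfolding homogenise_target_def by (intro poly_expr_if poly_expr.intros)
  show "homogenise_graph N L x i = x i" if "i < N" for x i
    using that by (simp add: homogenise_graph_def)
  show "perturbed_id (homogenise d N L) (homogenise_graph N L x) = homogenise_target N (perturbed_id L x)" for x
    by (rule perturbed_id_homogenise_graph[OF below degrees])
  fix w u i assume image: "perturbed_id (homogenise d N L) w = homogenise_target N u" and "i < N"
  have "w (2 * N) = 1"
    using fun_cong[OF image, of "2 * N"] perturbed_id_homogenise_top[OF below, of "2 * N" d w]
    by (simp add: homogenise_target_def)
  note components = perturbed_id_homogenise_low[of N L w, OF below this \<open>i < N\<close>, of d]
    perturbed_id_homogenise_mid[of N L w, OF below this, of d i]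
  have "w (N + i) + terms_eval (terms_of_degree {3} L) w i = 0"
    using fun_cong[OF image, of "N + i"] components(2) \<open>i < N\<close> by (simp add: homogenise_target_def)
  moreover have "w i + terms_eval (terms_of_degree {2} L) w i - w (N + i) = u i"
    using fun_cong[OF image, of i] components(1) \<open>i < N\<close> by (simp add: homogenise_target_def)
  ultimately show "perturbed_id L w i = u i"
    by (simp add: perturbed_id_def terms_sum_quadratic_cubic[OF degrees] algebra_simps
        eq_neg_iff_add_eq_0[symmetric])
qed

lemma reduce_to_homogeneous:
  fixes L :: "'a::comm_ring_1 monomial_term list"
  assumes "3 \<le> d"
    and homogeneous: "\<And>N (L :: 'a monomial_term list).
      vars_below N L \<Longrightarrow> degrees_in {d} L \<Longrightarrow> nonsingular L \<Longrightarrow> poly_invertible L"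
    and reducible: "vars_below N L" "degrees_in {2..} L" "nonsingular L"
  shows "poly_invertible L"
proof (rule reduce_to_cubic[OF _ reducible])
  fix N and L :: "'a monomial_term list"
  assume cubic: "vars_below N L" "degrees_in {2, 3} L" "nonsingular L"
  then have "poly_invertible (homogenise d N L)"
    using assms(1)
    by (intro homogeneous[OF vars_below_homogenise] degrees_in_homogenise nonsingular_homogenise)
  then show "poly_invertible L" by (rule poly_invertible_homogenise[OF cubic(1,2)])
qed

section \<open>Nilpotent operators\<close>

lemma (in vector_space) dependent_family_in_span:
  fixes u :: "nat \<Rightarrow> 'b"
  assumes "finite B" "\<And>j. u j \<in> span B"
  shows "\<exists>c. (\<exists>j\<le>card B. c j \<noteq> 0) \<and> (\<Sum>j\<le>card B. c j *s u j) = 0"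
proof (cases "inj_on u {..card B}")
  case True
  have "\<not> independent (u ` {..card B})"
  proof
    assume "independent (u ` {..card B})"
    then have "card (u ` {..card B}) \<le> card B"
      using independent_span_bound[OF assms(1)] assms(2) by blast
    then show False by (simp add: card_image[OF True])
  qed
  then obtain f where "\<exists>v\<in>u ` {..card B}. f v \<noteq> 0" "(\<Sum>v\<in>u ` {..card B}. f v *s v) = 0"
    by (auto simp: dependent_finite)
  then show ?thesis by (intro exI[of _ "f \<circ> u"]) (auto simp: sum.reindex[OF True])
next
  case False
  then obtain i j where ij: "i \<le> card B" "j \<le> card B" "i \<noteq> j" "u i = u j"
    by (auto simp: inj_on_def)
  define c :: "nat \<Rightarrow> 'a" where "c l = (if l = i then 1 else if l = j then - 1 else 0)" for l
  have "(\<Sum>l\<le>card B. c l *s u l) = (\<Sum>l\<in>{i, j}. c l *s u l)"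
    using ij by (intro sum.mono_neutral_right) (auto simp: c_def)
  also have "\<dots> = 0" using ij by (simp add: c_def)
  finally show ?thesis using ij(1) by (intro exI[of _ c]) (auto simp: c_def)
qed

locale no_nonzero_eigenvalue = Vector_Spaces.linear scale scale A
  for scale :: "'a::alg_closed_field \<Rightarrow> 'b::ab_group_add \<Rightarrow> 'b" (infixr \<open>\<cdot>\<close> 75) and A +
  assumes eigenvector_eq_0: "A v = s \<cdot> v \<Longrightarrow> s \<noteq> 0 \<Longrightarrow> v = 0"
begin

definition poly_op :: "'a poly \<Rightarrow> 'b \<Rightarrow> 'b" where
  "poly_op p v = (\<Sum>j\<le>degree p. coeff p j \<cdot> (A ^^ j) v)"

lemma funpow_zero: "(A ^^ n) 0 = 0"
  by (induction n) simp_all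

lemma poly_op_eq_sum: "degree p \<le> n \<Longrightarrow> poly_op p v = (\<Sum>j\<le>n. coeff p j \<cdot> (A ^^ j) v)"
  unfolding poly_op_def by (intro sum.mono_neutral_left) (auto simp: coeff_eq_0)

lemma operator_poly_op: "A (poly_op p v) = (\<Sum>j\<le>degree p. coeff p j \<cdot> (A ^^ Suc j) v)"
  by (simp add: poly_op_def sum scale)

lemma operator_poly_op_commute: "A (poly_op p v) = poly_op p (A v)"
  unfolding operator_poly_op by (simp add: poly_op_def funpow_swap1)

lemma poly_op_linear_factor: "poly_op ([:- l, 1:] * q) v = A (poly_op q v) - l \<cdot> poly_op q v"
proof -
  let ?n = "degree q"
  have "poly_op ([:- l, 1:] * q) v = (\<Sum>j\<le>Suc ?n. coeff ([:- l, 1:] * q) j \<cdot> (A ^^ j) v)"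
    using degree_mult_le[of "[:- l, 1:]" q] by (intro poly_op_eq_sum) simp
  also have "\<dots> = (\<Sum>j\<le>Suc ?n. coeff (pCons 0 q) j \<cdot> (A ^^ j) v) - l \<cdot> (\<Sum>j\<le>Suc ?n. coeff q j \<cdot> (A ^^ j) v)"
    by (simp add: vs1.scale_left_diff_distrib vs1.scale_sum_right sum_subtractf[symmetric]
        del: sum.atMost_Suc)
  also have "(\<Sum>j\<le>Suc ?n. coeff (pCons 0 q) j \<cdot> (A ^^ j) v) = A (poly_op q v)"
    unfolding operator_poly_op by (simp add: sum.atMost_Suc_shift del: sum.atMost_Suc)
  also have "(\<Sum>j\<le>Suc ?n. coeff q j \<cdot> (A ^^ j) v) = poly_op q v"
    by (rule poly_op_eq_sum[symmetric]) simp
  finally show ?thesis .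
qed

lemma funpow_degree_eq_0:
  assumes "p \<noteq> 0" "poly_op p v = 0"
  shows "(A ^^ degree p) v = 0"
  using assms
proof (induction "degree p" arbitrary: p v)
  case 0
  then have "coeff p 0 \<noteq> 0" by (metis leading_coeff_0_iff)
  then show ?case using 0 by (simp add: poly_op_def)
next
  case (Suc n)
  obtain l where "poly p l = 0" using alg_closed_imp_poly_has_root[of p] Suc.hyps(2) by auto
  then obtain q where q: "p = [:- l, 1:] * q" unfolding poly_eq_0_iff_dvd by (elim dvdE)
  have "q \<noteq> 0" using Suc.prems(1) q by auto
  then have degree: "n = degree q"
    using Suc.hyps(2) degree_mult_eq[of "[:- l, 1:]" q] unfolding q by simp
  have eigenvector: "A (poly_op q v) = l \<cdot> poly_op q v"
    using Suc.prems(2) unfolding q poly_op_linear_factor by simp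
  have "(A ^^ n) (A v) = 0"
  proof (cases "l = 0")
    case True
    then have "poly_op q (A v) = 0" using eigenvector by (simp add: operator_poly_op_commute)
    then show ?thesis using Suc.hyps(1)[OF degree \<open>q \<noteq> 0\<close>] degree by simp
  next
    case False
    then have "poly_op q v = 0" using eigenvector_eq_0[OF eigenvector] by simp
    then have "(A ^^ n) v = 0" using Suc.hyps(1)[OF degree \<open>q \<noteq> 0\<close>] degree by simp
    then show ?thesis by (simp add: funpow_swap1[symmetric])
  qed
  then show ?case using Suc.hyps(2) by (simp add: funpow_swap1 flip: Suc.hyps(2))
qed

lemma nilpotent:
  assumes "finite B" "\<And>v. A v \<in> vs1.span B"
  shows "(A ^^ Suc (card B)) v = 0"
proof -
  let ?N = "card B"
  have "(A ^^ j) (A v) \<in> vs1.span B" for j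
    using assms(2) by (cases j) simp_all
  then obtain c where relation: "\<exists>j\<le>?N. c j \<noteq> 0" "(\<Sum>j\<le>?N. c j \<cdot> (A ^^ j) (A v)) = 0"
    using vs1.dependent_family_in_span[OF assms(1), of "\<lambda>j. (A ^^ j) (A v)"] by blast
  define p where "p = (\<Sum>j\<le>?N. monom (c j) j)"
  have coeff: "coeff p j = (if j \<le> ?N then c j else 0)" for j
    by (simp add: p_def coeff_sum)
  have "p \<noteq> 0" using relation(1) coeff by (metis coeff_0)
  have degree: "degree p \<le> ?N" by (rule degree_le) (simp add: coeff)
  have "poly_op p (A v) = 0"
    unfolding poly_op_eq_sum[OF degree] using relation(2) by (simp add: coeff)
  then have "(A ^^ degree p) (A v) = 0" by (rule funpow_degree_eq_0[OF \<open>p \<noteq> 0\<close>])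
  then have "(A ^^ (?N - degree p + degree p)) (A v) = 0"
    unfolding funpow_add by (simp add: funpow_zero)
  then show ?thesis using degree by (simp add: funpow_swap1)
qed

end

interpretation function_space: vector_space "\<lambda>(s :: 'a::field) (f :: 'b \<Rightarrow> 'a) x. s * f x"
  by unfold_locales (simp_all add: fun_eq_iff algebra_simps)

lemma sum_fun_apply: "(\<Sum>a\<in>A. f a) x = (\<Sum>a\<in>A. f a x)"
  by (induction A rule: infinite_finite_induct) simp_all

lemma in_span_unit_functions:
  fixes f :: "nat \<Rightarrow> 'a::field"
  assumes "\<And>i. N \<le> i \<Longrightarrow> f i = 0"
  shows "f \<in> function_space.span ((\<lambda>k i. if i = k then 1 else 0) ` {..<N})"
proof -
  have "f = (\<Sum>k<N. (\<lambda>i. f k * (if i = k then 1 else 0)))"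
    using assms by (auto simp: fun_eq_iff sum_fun_apply not_less mult_delta_right)
  also have "\<dots> \<in> function_space.span ((\<lambda>k i. if i = k then 1 else 0) ` {..<N})"
    by (intro function_space.span_sum function_space.span_scale function_space.span_base imageI)
  finally show ?thesis .
qed

section \<open>Polarised monomials\<close>

definition polar :: "(nat \<Rightarrow> 'a::comm_ring_1) list \<Rightarrow> nat list \<Rightarrow> 'a" where
  "polar xs vs = (\<Sum>\<sigma> | \<sigma> permutes {..<length vs}. \<Prod>j<length vs. (xs ! j) (vs ! \<sigma> j))"

lemma prod_list_update_remove:
  assumes "j < n" "length xs = n"
  shows "(\<Prod>l<n. (xs[j := a] ! l) (f l)) = a (f j) * (\<Prod>l\<in>{..<n} - {j}. (xs ! l) (f l))"
proof -
  have "(\<Prod>l<n. (xs[j := a] ! l) (f l)) = (xs[j := a] ! j) (f j) * (\<Prod>l\<in>{..<n} - {j}. (xs[j := a] ! l) (f l))"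
    using assms by (intro prod.remove) auto
  also have "(\<Prod>l\<in>{..<n} - {j}. (xs[j := a] ! l) (f l)) = (\<Prod>l\<in>{..<n} - {j}. (xs ! l) (f l))"
    by (intro prod.cong) auto
  finally show ?thesis using assms by simp
qed

lemma polar_linear:
  assumes "length xs = length vs" "j < length vs"
  shows "polar (xs[j := (\<lambda>i. a i + s * b i)]) vs = polar (xs[j := a]) vs + s * polar (xs[j := b]) vs"
  unfolding polar_def prod_list_update_remove[OF assms(2,1)] sum_distrib_left sum.distrib[symmetric]
  by (intro sum.cong refl) (simp add: algebra_simps)

lemma polar_symmetric:
  assumes "length xs = length vs" "mset xs = mset ys"
  shows "polar xs vs = polar ys vs"
proof -
  let ?n = "length vs"
  have len: "length ys = ?n" using mset_eq_length[OF assms(2)] assms(1) by simp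
  obtain \<tau> where \<tau>: "\<tau> permutes {..<?n}" "permute_list \<tau> ys = xs"
    using mset_eq_permutation[OF assms(2)] unfolding len by blast
  have "polar xs vs = (\<Sum>\<sigma> | \<sigma> permutes {..<?n}. \<Prod>j<?n. (ys ! \<tau> j) (vs ! (\<sigma> \<circ> \<tau>) j))"
    unfolding polar_def sum_permutations_compose_right[OF \<tau>(1), of "\<lambda>\<sigma>. \<Prod>j<?n. (xs ! j) (vs ! \<sigma> j)"]
    using \<tau> len by (intro sum.cong prod.cong refl) (auto simp: permute_list_nth)
  also have "\<dots> = polar ys vs"
    unfolding polar_def
  proof (rule sum.cong[OF refl])
    fix \<sigma>
    show "(\<Prod>j<?n. (ys ! \<tau> j) (vs ! (\<sigma> \<circ> \<tau>) j)) = (\<Prod>j<?n. (ys ! j) (vs ! \<sigma> j))"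
      using prod.permute[OF \<tau>(1), of "\<lambda>j. (ys ! j) (vs ! \<sigma> j)"] by (simp add: o_def)
  qed
  finally show ?thesis .
qed

lemma mon_eq_prod: "mon x vs = (\<Prod>j<length vs. x (vs ! j))"
  by (induction vs) (simp_all add: prod.lessThan_Suc_shift del: prod.lessThan_Suc)

lemma polar_diagonal: "polar (replicate (length vs) x) vs = fact (length vs) * mon x vs"
proof -
  let ?n = "length vs"
  have "(\<Prod>j<?n. (replicate ?n x ! j) (vs ! \<sigma> j)) = mon x vs" if "\<sigma> permutes {..<?n}" for \<sigma>
    using prod.permute[OF that, of "\<lambda>j. x (vs ! j)"] by (simp add: mon_eq_prod o_def)
  then show ?thesis by (simp add: polar_def card_permutations)
qed

lemma mon_deriv_eq_sum:
  "mon_deriv x h vs = (\<Sum>i<length vs. \<Prod>j<length vs. ((replicate (length vs) x)[i := h] ! j) (vs ! j))"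
proof (induction vs)
  case (Cons v vs)
  have "(\<Prod>j<length vs. (replicate (length vs) x ! j) (vs ! j)) = mon x vs"
    by (simp add: mon_eq_prod)
  then show ?case
    by (simp add: Cons sum.lessThan_Suc_shift prod.lessThan_Suc_shift sum_distrib_left
        del: sum.lessThan_Suc prod.lessThan_Suc)
qed simp

lemma mon_deriv_mset_cong: "mset us = mset vs \<Longrightarrow> mon_deriv x h us = mon_deriv x h vs"
proof (induction us arbitrary: vs)
  case (Cons u us)
  then have "u \<in> set vs" by (metis list.set_intros(1) mset_eq_setD)
  then obtain as bs where vs: "vs = as @ u # bs" by (meson split_list)
  then have mset: "mset us = mset (as @ bs)" using Cons.prems by simp
  have "mon x us = mon x (as @ bs)"
    using arg_cong[OF mset, of "\<lambda>M. prod_mset (image_mset x M)"]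
    unfolding mon_def by (simp add: prod_mset_prod_list del: mset_append flip: mset_map)
  then show ?case by (simp add: vs Cons.IH[OF mset] algebra_simps)
qed simp

lemma polar_derivative:
  "of_nat (length vs) * polar (h # replicate (length vs - 1) x) vs = fact (length vs) * mon_deriv x h vs"
proof -
  let ?n = "length vs"
  have "polar ((replicate ?n x)[i := h]) vs = polar (h # replicate (?n - 1) x) vs" if "i < ?n" for i
    using mset_replicate_update[OF that] by (intro polar_symmetric) simp_all
  then have "of_nat ?n * polar (h # replicate (?n - 1) x) vs = (\<Sum>i<?n. polar ((replicate ?n x)[i := h]) vs)"
    by simp
  also have "\<dots> = (\<Sum>\<sigma> | \<sigma> permutes {..<?n}. \<Sum>i<?n. \<Prod>j<?n. ((replicate ?n x)[i := h] ! j) (vs ! \<sigma> j))"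
    unfolding polar_def by (rule sum.swap)
  also have "\<dots> = (\<Sum>\<sigma> | \<sigma> permutes {..<?n}. mon_deriv x h (permute_list \<sigma> vs))"
    by (intro sum.cong refl) (simp add: mon_deriv_eq_sum permute_list_nth)
  also have "\<dots> = (\<Sum>\<sigma> | \<sigma> permutes {..<?n}. mon_deriv x h vs)"
    by (intro sum.cong refl mon_deriv_mset_cong) simp
  finally show ?thesis by (simp add: card_permutations)
qed

lemma poly_expr_polar:
  assumes "\<And>t v. t \<in> set ts \<Longrightarrow> poly_expr (\<lambda>y. F y t v)" "length ts = length vs"
  shows "poly_expr (\<lambda>y. polar (map (F y) ts) vs)"
proof -
  have "polar (map (F y) ts) vs
      = (\<Sum>\<sigma> | \<sigma> permutes {..<length vs}. \<Prod>j<length vs. F y (ts ! j) (vs ! \<sigma> j))" for y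
    unfolding polar_def using assms(2) by (intro sum.cong prod.cong refl) auto
  then show ?thesis
    using assms by (auto intro!: poly_expr_sum poly_expr_prod)
qed

text \<open>The sign makes \<open>perturbed_id L\<close> the map \<open>id - K\<close> for the diagonal \<open>K\<close> of this form.\<close>
definition polar_form ::
  "nat \<Rightarrow> 'a::field_char_0 monomial_term list \<Rightarrow> (nat \<Rightarrow> 'a) list \<Rightarrow> nat \<Rightarrow> 'a" where
  "polar_form d L xs i = - terms_sum L (polar xs) i / fact d"

lemma polar_form_linear:
  assumes "degrees_in {d} L" "length xs = d" "j < d"
  shows "polar_form d L (xs[j := (\<lambda>i. a i + s * b i)]) i
       = polar_form d L (xs[j := a]) i + s * polar_form d L (xs[j := b]) i"
proof -
  have "terms_sum L (polar (xs[j := (\<lambda>i. a i + s * b i)])) i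
      = terms_sum L (\<lambda>vs. polar (xs[j := a]) vs + s * polar (xs[j := b]) vs) i"
    using assms by (intro terms_sum_cong polar_linear) (auto simp: degrees_in_def)
  also have "\<dots> = terms_sum L (polar (xs[j := a])) i + s * terms_sum L (polar (xs[j := b])) i"
    by (simp add: terms_sum_add terms_sum_mult)
  finally show ?thesis by (simp add: polar_form_def add_divide_distrib diff_divide_distrib)
qed

lemma polar_form_symmetric:
  assumes "degrees_in {d} L" "length xs = d" "mset xs = mset ys"
  shows "polar_form d L xs i = polar_form d L ys i"
  using assms unfolding polar_form_def
  by (auto intro!: terms_sum_cong polar_symmetric simp: degrees_in_def)

lemma polar_form_diagonal:
  assumes "degrees_in {d} L"
  shows "polar_form d L (replicate d x) i = - terms_eval L x i"
proof -
  have "terms_sum L (polar (replicate d x)) i = terms_sum L (\<lambda>vs. fact d * mon x vs) i"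
    using assms by (intro terms_sum_cong) (auto simp: degrees_in_def polar_diagonal)
  then show ?thesis by (simp add: polar_form_def terms_sum_mult)
qed

lemma polar_form_derivative:
  assumes "degrees_in {d} L"
  shows "of_nat d * polar_form d L (h # replicate (d - 1) x) i = - terms_deriv L x h i"
proof -
  have "of_nat d * terms_sum L (polar (h # replicate (d - 1) x)) i
      = terms_sum L (\<lambda>vs. fact d * mon_deriv x h vs) i"
    unfolding terms_sum_mult[symmetric] using assms
    by (intro terms_sum_cong) (use polar_derivative in \<open>force simp: degrees_in_def\<close>)
  then show ?thesis by (simp add: polar_form_def terms_sum_mult field_simps)
qed

lemma polar_form_outside: "vars_below N L \<Longrightarrow> N \<le> i \<Longrightarrow> polar_form d L xs i = 0"
  by (simp add: polar_form_def terms_sum_outside)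

lemma poly_expr_polar_form:
  assumes "\<And>t v. t \<in> set ts \<Longrightarrow> poly_expr (\<lambda>y. F y t v)" "degrees_in {d} L" "length ts = d"
  shows "poly_expr (\<lambda>y. polar_form d L (map (F y) ts) i)"
proof -
  have "poly_expr (\<lambda>y. terms_sum L (polar (map (F y) ts)) i)"
    using assms by (intro poly_expr_terms_sum poly_expr_polar) (auto simp: degrees_in_def)
  then have "poly_expr (\<lambda>y. (- 1 / fact d) * terms_sum L (polar (map (F y) ts)) i)"
    by (rule poly_expr.mult[OF poly_expr.const])
  then show ?thesis by (simp add: polar_form_def)
qed

section \<open>Homogeneous perturbations\<close>

definition uniform_shuffle_chains :: "nat \<Rightarrow> bool" where
  "uniform_shuffle_chains d \<longleftrightarrow>
     (\<forall>p\<ge>1. \<exists>k0. \<forall>k\<ge>k0. \<exists>P. is_shuffle_family d p k P \<and> uniform_stationary d p k P)"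

definition node_value ::
  "nat \<Rightarrow> 'a::field_char_0 monomial_term list \<Rightarrow> (nat \<Rightarrow> 'a) \<Rightarrow> (nat \<Rightarrow> 'a) list \<Rightarrow> nat \<Rightarrow> 'a" where
  "node_value d L y xs = (if xs = [] then y else polar_form d L xs)"

locale homogeneous_perturbation =
  fixes d N :: nat and L :: "complex monomial_term list"
  assumes degree_ge_2: "2 \<le> d"
    and below: "vars_below N L"
    and degrees: "degrees_in {d} L"
    and nonsing: "nonsingular L"
begin

sublocale tree: symmetric_multi_additive d "node_value d L y" for y
proof
  show "0 < d" using degree_ge_2 by simp
  fix xs ys :: "(nat \<Rightarrow> complex) list" and j and a b :: "nat \<Rightarrow> complex"
  assume len: "length xs = d"
  then have "xs \<noteq> []" using degree_ge_2 by auto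
  have sum_eq: "a + b = (\<lambda>i. a i + 1 * b i)" by (simp add: fun_eq_iff)
  show "node_value d L y (xs[j := a + b]) = node_value d L y (xs[j := a]) + node_value d L y (xs[j := b])"
    if "j < d"
    using polar_form_linear[OF degrees len that, of a 1 b] \<open>xs \<noteq> []\<close>
    by (intro ext) (simp add: sum_eq node_value_def)
  show "node_value d L y xs = node_value d L y ys" if "mset xs = mset ys"
    using polar_form_symmetric[OF degrees len that] that \<open>xs \<noteq> []\<close>
    by (auto simp: node_value_def fun_eq_iff)
qed

lemma mult_op_eq: "tree.mult_op y x h = polar_form d L (h # replicate (d - 1) x)"
  unfolding tree.mult_op_def by (simp add: node_value_def)

lemma mult_op_diagonal: "tree.mult_op y x x i = - terms_eval L x i"
proof -
  have "x # replicate (d - 1) x = replicate d x" using degree_ge_2 by (cases d) simp_all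
  then show ?thesis by (simp add: mult_op_eq polar_form_diagonal[OF degrees] del: One_nat_def)
qed

lemma terms_deriv_eq_mult_op: "terms_deriv L x h i = - (of_nat d * tree.mult_op y x h i)"
  using polar_form_derivative[OF degrees, of h x i] by (simp add: mult_op_eq)

text \<open>By homogeneity, an eigenvector of the derivative at \<open>x\<close> is a kernel vector of the derivative
  of \<open>perturbed_id L\<close> at a multiple of \<open>x\<close>.\<close>
lemma no_nonzero_eigenvalue_mult_op:
  "no_nonzero_eigenvalue (\<lambda>(s :: complex) v i. s * v i) (tree.mult_op y x)"
proof
  have linear: "tree.mult_op y x (\<lambda>i. u i + s * v i) i = tree.mult_op y x u i + s * tree.mult_op y x v i"
    for u v s i
    using polar_form_linear[OF degrees, of "undefined # replicate (d - 1) x" 0 u s v] degree_ge_2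
    by (simp add: mult_op_eq)
  show "tree.mult_op y x (u + v) = tree.mult_op y x u + tree.mult_op y x v" for u v
    using linear[of u 1 v] by (simp add: fun_eq_iff plus_fun_def)
  show "tree.mult_op y x (\<lambda>i. s * v i) = (\<lambda>i. s * tree.mult_op y x v i)" for s v
    using linear[of "\<lambda>_. 0" s v] linear[of "\<lambda>_. 0" "- 1" "\<lambda>_. 0"] by (simp add: fun_eq_iff)
  show "h = 0" if eigenvector: "tree.mult_op y x h = (\<lambda>i. s * h i)" and "s \<noteq> 0" for h s
  proof -
    obtain r where "r ^ (d - 1) = 1 / (of_nat d * s)"
      using nth_root_exists[of "d - 1" "1 / (of_nat d * s)"] degree_ge_2 by auto
    then have "r ^ (d - 1) * (of_nat d * s) = 1"
      using degree_ge_2 \<open>s \<noteq> 0\<close> by simp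
    then have "h i + terms_deriv L (\<lambda>i. r * x i) h i = 0" for i
      using fun_cong[OF eigenvector, of i]
      by (simp add: terms_deriv_scale[OF degrees] terms_deriv_eq_mult_op[of _ _ _ y])
    then show ?thesis using nonsing unfolding nonsingular_def by (simp add: fun_eq_iff) blast
  qed
qed

lemma mult_op_nilpotent: "\<exists>p\<ge>1. \<forall>y x h. (tree.mult_op y x ^^ p) h = 0"
proof (intro exI conjI allI)
  let ?B = "(\<lambda>k i. if i = k then 1 else 0 :: complex) ` {..<N}"
  fix y x h
  have "tree.mult_op y x v \<in> function_space.span ?B" for v
    by (rule in_span_unit_functions) (simp add: mult_op_eq polar_form_outside[OF below])
  then show "(tree.mult_op y x ^^ Suc (card ?B)) h = 0"
    by (intro no_nonzero_eigenvalue.nilpotent[OF no_nonzero_eigenvalue_mult_op]) simp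
qed simp

lemma tree_sum_eventually_0:
  assumes "uniform_shuffle_chains d"
  shows "\<exists>K. \<forall>k\<ge>K. \<forall>y. tree.tree_sum y k = 0"
proof -
  obtain p where "1 \<le> p" and nilpotent: "\<And>y x h. (tree.mult_op y x ^^ p) h = 0"
    using mult_op_nilpotent by blast
  obtain K where chain: "\<And>k. K \<le> k \<Longrightarrow> \<exists>P. is_shuffle_family d p k P \<and> uniform_stationary d p k P"
    using assms \<open>1 \<le> p\<close> unfolding uniform_shuffle_chains_def by blast
  have "tree.tree_sum y k i = 0" if "K \<le> k" for k y i
  proof -
    obtain P where "is_shuffle_family d p k P" "uniform_stationary d p k P" using chain \<open>K \<le> k\<close> by blast
    then show ?thesis
      using tree.additive_tree_sum_eq_0[where \<phi> = "\<lambda>v. v i", OF _ nilpotent]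
      by (simp add: Modules.additive_def)
  qed
  then show ?thesis by (auto simp: fun_eq_iff)
qed

lemma poly_expr_tree_value:
  "is_catalan d T \<Longrightarrow> poly_expr (\<lambda>y. tree_value (node_value d L y) T i)"
proof (induction T arbitrary: i)
  case (Node ts)
  show ?case
  proof (cases "ts = []")
    case True
    then show ?thesis by (simp add: tree_value_Node node_value_def poly_expr.var)
  next
    case False
    then have len: "length ts = d" using Node.prems by (simp add: is_catalan_Node)
    have "poly_expr (\<lambda>y. polar_form d L (map (tree_value (node_value d L y)) ts) i)"
      using Node by (intro poly_expr_polar_form[OF _ degrees len]) (auto simp: is_catalan_Node)
    then show ?thesis using False unfolding tree_value_Node by (subst node_value_def) simp
  qed
qed

lemma poly_expr_tree_sum: "poly_expr (\<lambda>y. tree.tree_sum y k i)"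
  unfolding tree.tree_sum_def sum_fun_apply
  by (intro poly_expr_sum poly_expr_tree_value) (simp add: catalan_trees_alt)

lemma perturbed_id_tree_sum:
  assumes "\<And>k. K \<le> k \<Longrightarrow> tree.tree_sum y k = 0"
  shows "perturbed_id L (\<Sum>k<K. tree.tree_sum y k) = y"
proof
  fix i
  have "(\<Sum>k<K. tree.tree_sum y k) i = y i - terms_eval L (\<Sum>k<K. tree.tree_sum y k) i"
    using fun_cong[OF tree.tree_sum_fixed_point[of K y], OF assms, of i] tree.d_pos
    by (simp add: node_value_def polar_form_diagonal[OF degrees])
  then show "perturbed_id L (\<Sum>k<K. tree.tree_sum y k) i = y i"
    by (simp add: perturbed_id_def)
qed

lemma perturbed_id_eq_0_imp:
  assumes "perturbed_id L x = (\<lambda>_. 0)"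
  shows "x = (\<lambda>_. 0)"
proof -
  have "terms_eval L x i = - x i" for i
    using fun_cong[OF assms, of i] by (simp add: perturbed_id_def add_eq_0_iff)
  then have "tree.mult_op 0 x x = (\<lambda>i. 1 * x i)"
    by (simp add: fun_eq_iff mult_op_diagonal)
  from no_nonzero_eigenvalue.eigenvector_eq_0[OF no_nonzero_eigenvalue_mult_op this]
  show ?thesis by (simp add: zero_fun_def)
qed

theorem poly_invertible_if_uniform_shuffle_chains:
  assumes "uniform_shuffle_chains d"
  shows "poly_invertible L"
proof -
  obtain K where vanish: "\<And>k y. K \<le> k \<Longrightarrow> tree.tree_sum y k = 0"
    using tree_sum_eventually_0[OF assms] by blast
  define G where "G y = (\<Sum>k<K. tree.tree_sum y k)" for y
  have poly: "poly_expr (\<lambda>y. G y i)" for i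
    unfolding G_def sum_fun_apply by (intro poly_expr_sum poly_expr_tree_sum)
  have right_inverse: "perturbed_id L (G y) = y" for y
    unfolding G_def using vanish by (rule perturbed_id_tree_sum)
  have "degrees_in {2..} L"
    using degrees degree_ge_2 by (auto intro: degrees_in_mono)
  then have "G (perturbed_id L x) = x" for x
    using poly right_inverse perturbed_id_eq_0_imp[OF right_inverse]
    by (rule right_inverse_imp_left_inverse)
  then show ?thesis unfolding poly_invertible_def using poly right_inverse by blast
qed

end

section \<open>Polynomial functions on complex affine space\<close>

lemma poly_fun_monomial_family:
  fixes m :: "'a \<Rightarrow> 'n::finite \<Rightarrow> nat"
  assumes "finite A"
  shows "poly_fun (\<lambda>x :: complex ^ 'n. \<Sum>a\<in>A. c a * (\<Prod>i\<in>UNIV. (x $ i) ^ m a i))"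
proof -
  have "(\<Sum>a\<in>A. c a * (\<Prod>i\<in>UNIV. (x $ i) ^ m a i))
      = (\<Sum>q\<in>m ` A. (\<Sum>a | a \<in> A \<and> m a = q. c a) * (\<Prod>i\<in>UNIV. (x $ i) ^ q i))" for x :: "complex ^ 'n"
    unfolding sum_distrib_right by (subst sum.image_gen[OF assms, of _ m]) (intro sum.cong refl, auto)
  then show ?thesis
    unfolding poly_fun_def using assms
    by (intro exI[of _ "m ` A"] exI[of _ "\<lambda>q. \<Sum>a | a \<in> A \<and> m a = q. c a"]) simp
qed

lemma poly_fun_const: "poly_fun (\<lambda>_ :: complex ^ 'n. c)"
  using poly_fun_monomial_family[of "{()}" "\<lambda>_. c" "\<lambda>_ _. 0"] by simp

lemma poly_fun_var: "poly_fun (\<lambda>x :: complex ^ 'n. x $ i)"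
proof -
  have "(\<Prod>j\<in>UNIV. (x $ j) ^ (if j = i then 1 else 0)) = x $ i" for x :: "complex ^ 'n"
    by (simp add: if_distrib[of "(^) _"] cong: if_cong)
  then show ?thesis
    using poly_fun_monomial_family[of "{()}" "\<lambda>_. 1" "\<lambda>_ j. if j = i then 1 else 0"] by simp
qed

lemma poly_fun_add:
  assumes "poly_fun f" "poly_fun g"
  shows "poly_fun (\<lambda>x. f x + g x)"
proof -
  obtain S c where f: "finite S" "\<And>x. f x = (\<Sum>m\<in>S. c m * (\<Prod>i\<in>UNIV. (x $ i) ^ m i))"
    using assms(1) unfolding poly_fun_def by blast
  obtain S' c' where g: "finite S'" "\<And>x. g x = (\<Sum>m\<in>S'. c' m * (\<Prod>i\<in>UNIV. (x $ i) ^ m i))"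
    using assms(2) unfolding poly_fun_def by blast
  show ?thesis
    using poly_fun_monomial_family[of "S <+> S'" "case_sum c c'" "case_sum id id"] f g
    by (simp add: sum.Plus o_def)
qed

lemma poly_fun_mult:
  assumes "poly_fun f" "poly_fun g"
  shows "poly_fun (\<lambda>x. f x * g x)"
proof -
  obtain S c where f: "finite S" "\<And>x. f x = (\<Sum>m\<in>S. c m * (\<Prod>i\<in>UNIV. (x $ i) ^ m i))"
    using assms(1) unfolding poly_fun_def by blast
  obtain S' c' where g: "finite S'" "\<And>x. g x = (\<Sum>m\<in>S'. c' m * (\<Prod>i\<in>UNIV. (x $ i) ^ m i))"
    using assms(2) unfolding poly_fun_def by blast
  have "f x * g x = (\<Sum>(m, m')\<in>S \<times> S'. c m * c' m' * (\<Prod>i\<in>UNIV. (x $ i) ^ (m i + m' i)))" for x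
    unfolding f(2) g(2) sum_product sum.cartesian_product
    by (simp add: power_add prod.distrib mult_ac)
  then show ?thesis
    using poly_fun_monomial_family[of "S \<times> S'" "\<lambda>(m, m'). c m * c' m'" "\<lambda>(m, m') i. m i + m' i"] f(1) g(1)
    by (simp add: case_prod_unfold)
qed

lemma poly_fun_sum: "(\<And>a. a \<in> A \<Longrightarrow> poly_fun (f a)) \<Longrightarrow> poly_fun (\<lambda>x. \<Sum>a\<in>A. f a x)"
  by (induction A rule: infinite_finite_induct) (auto intro: poly_fun_const poly_fun_add)

lemma poly_fun_prod: "(\<And>a. a \<in> A \<Longrightarrow> poly_fun (f a)) \<Longrightarrow> poly_fun (\<lambda>x. \<Prod>a\<in>A. f a x)"
  by (induction A rule: infinite_finite_induct) (auto intro: poly_fun_const poly_fun_mult)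

lemma poly_fun_power: "poly_fun f \<Longrightarrow> poly_fun (\<lambda>x. f x ^ k)"
  by (induction k) (auto intro: poly_fun_const poly_fun_mult)

lemma poly_fun_poly_expr:
  assumes "poly_expr f" "\<And>i. poly_fun (\<lambda>x. g x i)"
  shows "poly_fun (\<lambda>x. f (g x))"
  using assms(1)
  by (induction rule: poly_expr.induct) (auto intro: poly_fun_const poly_fun_add poly_fun_mult assms(2))

lemma poly_map_compose:
  assumes "poly_map G" "poly_map F"
  shows "poly_map (\<lambda>x. G (F x))"
  unfolding poly_map_def
proof
  fix j
  obtain S c where "\<And>x. G x $ j = (\<Sum>m\<in>S. c m * (\<Prod>i\<in>UNIV. (x $ i) ^ m i))"
    using assms(1) unfolding poly_map_def poly_fun_def by blast
  moreover have "poly_fun (\<lambda>x. \<Sum>m\<in>S. c m * (\<Prod>i\<in>UNIV. (F x $ i) ^ m i))"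
    using assms(2) unfolding poly_map_def
    by (intro poly_fun_sum poly_fun_mult poly_fun_const poly_fun_prod poly_fun_power) blast
  ultimately show "poly_fun (\<lambda>x. G (F x) $ j)" by simp
qed

lemma poly_map_affine: "poly_map (\<lambda>x :: complex ^ 'n. B *v (x - a))"
  unfolding poly_map_def
proof
  fix i
  have "poly_fun (\<lambda>x :: complex ^ 'n. \<Sum>l\<in>UNIV. B $ i $ l * (x $ l + (- a $ l)))"
    by (intro poly_fun_sum poly_fun_mult poly_fun_add poly_fun_const poly_fun_var)
  then show "poly_fun (\<lambda>x. (B *v (x - a)) $ i)" by (simp add: matrix_vector_mult_def)
qed

section \<open>Normalisation of Keller maps\<close>

lemma poly_fun_partially_differentiable:
  assumes "poly_fun f"
  shows "(\<lambda>t. f (\<chi> k. if k = j then t else x $ k)) field_differentiable at z"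
proof -
  obtain S c where f: "\<And>x. f x = (\<Sum>m\<in>S. c m * (\<Prod>i\<in>UNIV. (x $ i) ^ m i))"
    using assms unfolding poly_fun_def by blast
  have "(\<lambda>t. if i = j then t else x $ i) holomorphic_on UNIV" for i
    by (cases "i = j") (simp_all add: holomorphic_on_ident)
  then have "(\<lambda>t. f (\<chi> k. if k = j then t else x $ k)) holomorphic_on UNIV"
    unfolding f vec_lambda_beta by (intro holomorphic_intros)
  then show ?thesis by (simp add: holomorphic_on_def)
qed

lemma jacobian_matrix_affine:
  assumes "poly_map F"
  shows "jacobian_matrix (\<lambda>x. B *v (F x - a)) x = B ** jacobian_matrix F x"
proof -
  define partial where "partial l j t = F (\<chi> k. if k = j then t else x $ k) $ l" for l j t
  have "(partial l j has_field_derivative deriv (partial l j) (x $ j)) (at (x $ j))" for l j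
    using assms unfolding poly_map_def partial_def
    by (intro field_differentiable_derivI poly_fun_partially_differentiable) blast
  from DERIV_diff[OF this DERIV_const]
  have "deriv (\<lambda>t. \<Sum>l\<in>UNIV. B $ i $ l * (partial l j t - a $ l)) (x $ j)
      = (\<Sum>l\<in>UNIV. B $ i $ l * (deriv (partial l j) (x $ j) - 0))" for i j
    by (intro DERIV_imp_deriv DERIV_sum DERIV_cmult)
  then show ?thesis
    by (simp add: jacobian_matrix_def matrix_matrix_mult_def matrix_vector_mult_def vec_eq_iff
        partial_def[abs_def])
qed

lemma keller_map_affine:
  assumes "keller_map F" "invertible B"
  shows "keller_map (\<lambda>x. B *v (F x - a))"
proof -
  have "poly_map F" and "\<exists>c. c \<noteq> 0 \<and> (\<forall>x. det (jacobian_matrix F x) = c)"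
    using assms(1) by (auto simp: keller_map_def)
  moreover have "det B \<noteq> 0" using assms(2) by (simp add: invertible_det_nz)
  ultimately show ?thesis
    using poly_map_compose[OF poly_map_affine]
    by (auto simp: keller_map_def jacobian_matrix_affine det_mul)
qed

lemma poly_automorphism_affine_cancel:
  assumes "poly_map F" "invertible B" "poly_automorphism (\<lambda>x. B *v (F x - a))"
  shows "poly_automorphism F"
proof -
  obtain G where inverse: "poly_map G" "\<And>x. G (B *v (F x - a)) = x" "\<And>w. B *v (F (G w) - a) = w"
    using assms(3) by (auto simp: poly_automorphism_def fun_eq_iff)
  have "F (G (B *v (w - a))) = w" for w
  proof -
    have "F (G (B *v (w - a))) - a = w - a"
      using inverse(3)[of "B *v (w - a)"] inj_matrix_vector_mult[OF assms(2)] by (rule injD[rotated])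
    then show ?thesis by simp
  qed
  then show ?thesis
    unfolding poly_automorphism_def
    using assms(1) inverse(2) poly_map_compose[OF inverse(1) poly_map_affine]
    by (intro conjI exI[of _ "\<lambda>w. G (B *v (w - a))"]) (auto simp: fun_eq_iff)
qed

lemma keller_map_imp_automorphism_if_normalised:
  fixes F :: "complex ^ 'n \<Rightarrow> complex ^ 'n"
  assumes normalised: "\<And>F :: complex ^ 'n \<Rightarrow> complex ^ 'n.
      keller_map F \<Longrightarrow> F 0 = 0 \<Longrightarrow> jacobian_matrix F 0 = mat 1 \<Longrightarrow> poly_automorphism F"
    and keller: "keller_map F"
  shows "poly_automorphism F"
proof -
  have poly: "poly_map F" using keller by (simp add: keller_map_def)
  have "det (jacobian_matrix F 0) \<noteq> 0" using keller by (auto simp: keller_map_def)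
  then obtain B where left_inverse: "B ** jacobian_matrix F 0 = mat 1" "invertible B"
    unfolding invertible_det_nz[symmetric] invertible_def by blast
  let ?F = "\<lambda>x. B *v (F x - F 0)"
  have "poly_automorphism ?F"
  proof (rule normalised)
    show "keller_map ?F" by (rule keller_map_affine[OF keller left_inverse(2)])
    show "jacobian_matrix ?F 0 = mat 1" by (simp add: jacobian_matrix_affine[OF poly] left_inverse(1))
  qed simp
  then show ?thesis by (rule poly_automorphism_affine_cancel[OF poly left_inverse(2)])
qed

section \<open>Keller maps in coordinates\<close>

lemma has_field_derivative_mon:
  "((\<lambda>t. mon (x(v := t)) vs) has_field_derivative mon_deriv x (\<lambda>l. if l = v then 1 else 0) vs) (at (x v))"
proof (induction vs)
  case (Cons u vs)
  have "((\<lambda>t. (x(v := t)) u) has_field_derivative (if u = v then 1 else 0)) (at (x v))"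
    by (cases "u = v") auto
  from DERIV_mult[OF this Cons] show ?case by (simp add: algebra_simps)
qed simp

lemma has_field_derivative_terms_eval:
  "((\<lambda>t. terms_eval L (x(v := t)) i) has_field_derivative
     terms_deriv L x (\<lambda>l. if l = v then 1 else 0) i) (at (x v))"
proof (induction L rule: monomial_terms_induct)
  case (Cons c vs k L)
  have "((\<lambda>t. if k = i then c * mon (x(v := t)) vs else 0) has_field_derivative
      (if k = i then c * mon_deriv x (\<lambda>l. if l = v then 1 else 0) vs else 0)) (at (x v))"
    by (cases "k = i") (auto intro: DERIV_cmult has_field_derivative_mon)
  from DERIV_add[OF this Cons] show ?case unfolding terms_sum_simps .
qed simp

lemma mon_deriv_sum: "mon_deriv x (\<lambda>i. \<Sum>k\<in>K. a k * u k i) vs = (\<Sum>k\<in>K. a k * mon_deriv x (u k) vs)"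
  by (induction vs) (simp_all add: sum_distrib_left sum_distrib_right sum.distrib algebra_simps)

lemma terms_deriv_sum: "terms_deriv L x (\<lambda>i. \<Sum>k\<in>K. a k * u k i) i = (\<Sum>k\<in>K. a k * terms_deriv L x (u k) i)"
  by (induction L rule: monomial_terms_induct)
    (simp_all add: mon_deriv_sum sum_distrib_left sum.distrib algebra_simps)

lemma mon_taylor:
  fixes x :: "nat \<Rightarrow> 'a::comm_ring_1"
  assumes "length vs < 2"
  shows "mon x vs = mon (\<lambda>_. 0) vs + mon_deriv (\<lambda>_. 0) x vs"
    and "mon_deriv x h vs = mon_deriv (\<lambda>_. 0) h vs"
  using assms by (cases vs rule: list.exhaust; cases "tl vs"; simp)+

lemma terms_eval_taylor:
  fixes x :: "nat \<Rightarrow> 'a::comm_ring_1"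
  shows "terms_eval L x i = terms_eval L (\<lambda>_. 0) i + terms_deriv L (\<lambda>_. 0) x i
     + terms_eval (terms_of_degree {2..} L) x i"
proof (induction L rule: monomial_terms_induct)
  case (Cons c vs k L)
  have "mon (\<lambda>_. 0) vs = (0 :: 'a)" "mon_deriv (\<lambda>_. 0) x vs = 0" if "\<not> length vs < 2"
    using that by (auto intro!: mon_zero mon_deriv_zero)
  then show ?case
    using Cons mon_taylor(1)[of vs x]
    by (cases "length vs < 2") (auto simp: terms_of_degree_def algebra_simps)
qed (simp add: terms_of_degree_def)

lemma terms_deriv_taylor:
  "terms_deriv L x h i = terms_deriv L (\<lambda>_. 0) h i + terms_deriv (terms_of_degree {2..} L) x h i"
proof (induction L rule: monomial_terms_induct)
  case (Cons c vs k L)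
  then show ?case
    using mon_taylor(2)[of vs x h] mon_deriv_zero[of vs h]
    by (cases "length vs < 2") (auto simp: terms_of_degree_def algebra_simps)
qed (simp add: terms_of_degree_def)

lemma terms_sum_map_component:
  "terms_sum (map (\<lambda>(c, vs). (c, vs, l)) M) \<phi> i = (if l = i then \<Sum>(c, vs)\<leftarrow>M. c * \<phi> vs else 0)"
  by (induction M) auto

lemma terms_sum_concat_components:
  "terms_sum (concat (map (\<lambda>l. map (\<lambda>(c, vs). (c, vs, l)) (M l)) [0..<N])) \<phi> i
     = (if i < N then \<Sum>(c, vs)\<leftarrow>M i. c * \<phi> vs else 0)"
  by (induction N) (auto simp: terms_sum_map_component)

locale coordinates =
  fixes e :: "nat \<Rightarrow> 'n::finite" and n :: nat
  assumes bij: "bij_betw e {..<n} UNIV"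
begin

definition ix :: "'n \<Rightarrow> nat" where
  "ix = inv_into {..<n} e"

definition emb :: "complex ^ 'n \<Rightarrow> nat \<Rightarrow> complex" where
  "emb x i = (if i < n then x $ e i else 0)"

definition proj :: "(nat \<Rightarrow> complex) \<Rightarrow> complex ^ 'n" where
  "proj w = (\<chi> j. w (ix j))"

lemma ix_less [simp]: "ix j < n" and e_ix [simp]: "e (ix j) = j"
  using bij_betw_inv_into[OF bij] bij_betw_inv_into_right[OF bij, of j]
  by (auto simp: ix_def bij_betw_def)

lemma ix_e [simp]: "i < n \<Longrightarrow> ix (e i) = i"
  using bij_betw_inv_into_left[OF bij] by (simp add: ix_def)

lemma emb_ix [simp]: "emb x (ix j) = x $ j"
  by (simp add: emb_def)

lemma proj_nth [simp]: "proj w $ j = w (ix j)"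
  by (simp add: proj_def)

lemma proj_emb [simp]: "proj (emb x) = x"
  by (simp add: vec_eq_iff)

lemma emb_proj: "(\<And>i. n \<le> i \<Longrightarrow> w i = 0) \<Longrightarrow> emb (proj w) = w"
  by (auto simp: emb_def proj_def fun_eq_iff)

lemma emb_proj_below: "i < n \<Longrightarrow> emb (proj w) i = w i"
  by (simp add: emb_def proj_def)

lemma eq_ix_iff: "i = ix k \<longleftrightarrow> i < n \<and> k = e i"
  by auto

lemma emb_eq_sum: "emb h = (\<lambda>i. \<Sum>k\<in>UNIV. h $ k * (if i = ix k then 1 else 0))"
  by (auto simp: fun_eq_iff emb_def eq_ix_iff mult_delta_right)

lemma emb_eqI:
  assumes "\<And>j. w (ix j) = x $ j" "\<And>i. n \<le> i \<Longrightarrow> w i = 0"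
  shows "w = emb x"
proof
  fix i
  show "w i = emb x i" using assms(1)[of "e i"] assms(2)[of i] by (cases "i < n") (auto simp: emb_def)
qed

definition word :: "('n \<Rightarrow> nat) \<Rightarrow> nat list" where
  "word m = concat (map (\<lambda>i. replicate (m (e i)) i) [0..<n])"

lemma set_word: "set (word m) \<subseteq> {..<n}"
  by (auto simp: word_def)

lemma mon_emb_word: "mon (emb x) (word m) = (\<Prod>k\<in>UNIV. (x $ k) ^ m k)"
proof -
  have "mon y (concat (map (\<lambda>i. replicate (m (e i)) i) [0..<l])) = (\<Prod>i<l. y i ^ m (e i))"
    for l and y :: "nat \<Rightarrow> complex"
    by (induction l) simp_all
  then have "mon (emb x) (word m) = (\<Prod>i<n. (x $ e i) ^ m (e i))"
    unfolding word_def by (simp add: emb_def)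
  also have "\<dots> = (\<Prod>k\<in>UNIV. (x $ k) ^ m k)"
    by (rule prod.reindex_bij_betw[OF bij])
  finally show ?thesis .
qed

lemma poly_fun_as_monomials:
  assumes "poly_fun f"
  shows "\<exists>M. (\<forall>(c, vs)\<in>set M. set vs \<subseteq> {..<n}) \<and> (\<forall>x. f x = (\<Sum>(c, vs)\<leftarrow>M. c * mon (emb x) vs))"
proof -
  obtain S c where "finite S" and f: "\<And>x. f x = (\<Sum>m\<in>S. c m * (\<Prod>i\<in>UNIV. (x $ i) ^ m i))"
    using assms unfolding poly_fun_def by blast
  obtain ms where ms: "distinct ms" "set ms = S" using finite_distinct_list[OF \<open>finite S\<close>] by blast
  let ?M = "map (\<lambda>m. (c m, word m)) ms"
  have "f x = (\<Sum>(c, vs)\<leftarrow>?M. c * mon (emb x) vs)" for x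
    using ms by (simp add: f mon_emb_word o_def sum_list_distinct_conv_sum_set)
  moreover have "\<forall>(c, vs)\<in>set ?M. set vs \<subseteq> {..<n}" using set_word by auto
  ultimately show ?thesis by blast
qed

lemma poly_map_as_terms:
  assumes "poly_map F"
  shows "\<exists>L. vars_below n L \<and> (\<forall>x j. F x $ j = terms_eval L (emb x) (ix j))"
proof -
  have "\<forall>j. \<exists>M. (\<forall>(c, vs)\<in>set M. set vs \<subseteq> {..<n}) \<and> (\<forall>x. F x $ j = (\<Sum>(c, vs)\<leftarrow>M. c * mon (emb x) vs))"
    using assms poly_fun_as_monomials unfolding poly_map_def by blast
  then obtain M where M_vars: "\<And>j. \<forall>(c, vs)\<in>set (M j). set vs \<subseteq> {..<n}"
    and F_eq: "\<And>j x. F x $ j = (\<Sum>(c, vs)\<leftarrow>M j. c * mon (emb x) vs)"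
    by metis
  let ?L = "concat (map (\<lambda>l. map (\<lambda>(c, vs). (c, vs, l)) (M (e l))) [0..<n])"
  have "F x $ j = terms_eval ?L (emb x) (ix j)" for x j
    by (simp add: F_eq terms_sum_concat_components)
  moreover have "vars_below n ?L" using M_vars by (fastforce simp: vars_below_def)
  ultimately show ?thesis by blast
qed

lemma jacobian_matrix_mult:
  assumes F_terms: "\<And>x j. F x $ j = terms_eval L (emb x) (ix j)"
  shows "(jacobian_matrix F x *v h) $ j = terms_deriv L (emb x) (emb h) (ix j)"
proof -
  have line: "emb (\<chi> l. if l = k then t else x $ l) = (emb x)(ix k := t)" for k t
    by (auto simp: emb_def fun_eq_iff)
  have "jacobian_matrix F x $ j $ k = terms_deriv L (emb x) (\<lambda>l. if l = ix k then 1 else 0) (ix j)" for k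
    using DERIV_imp_deriv[OF has_field_derivative_terms_eval[of L "emb x" "ix k" "ix j"]]
    by (simp add: jacobian_matrix_def F_terms line)
  then have "(jacobian_matrix F x *v h) $ j
      = (\<Sum>k\<in>UNIV. h $ k * terms_deriv L (emb x) (\<lambda>l. if l = ix k then 1 else 0) (ix j))"
    by (simp add: matrix_vector_mult_def mult.commute)
  also have "\<dots> = terms_deriv L (emb x) (emb h) (ix j)"
    unfolding emb_eq_sum[of h] terms_deriv_sum ..
  finally show ?thesis .
qed

lemma nonsingular_if_derivative_invertible:
  assumes below: "vars_below n L"
    and derivative: "\<And>x h j. h $ j + terms_deriv L (emb x) (emb h) (ix j) = (J x *v h) $ j"
    and invertible: "\<And>x. invertible (J x)"
  shows "nonsingular L"
  unfolding nonsingular_def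
proof (intro allI impI)
  fix x h i assume kernel: "\<forall>i. h i + terms_deriv L x h i = 0"
  have "h i = 0" if "n \<le> i" for i
    using kernel[rule_format, of i] terms_sum_outside[OF below that] by simp
  then have emb_h: "emb (proj h) = h" by (rule emb_proj)
  have "(J (proj x) *v proj h) $ j = 0" for j
  proof -
    have "terms_deriv L (emb (proj x)) h (ix j) = terms_deriv L x h (ix j)"
      by (rule terms_deriv_cong[OF below]) (simp_all add: emb_proj_below)
    then show ?thesis
      using kernel[rule_format, of "ix j"] derivative[of "proj h" j "proj x"]
      by (simp add: emb_h)
  qed
  then have "J (proj x) *v proj h = 0" by (simp add: vec_eq_iff)
  then have "proj h = 0"
    using invertible by (metis inj_matrix_vector_mult injD matrix_vector_mult_0_right)
  then have "h = emb 0" using emb_h by simp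
  then show "h i = 0" by (simp add: emb_def)
qed

lemma normalised_keller_map_as_perturbed_id:
  assumes normalised: "keller_map F" "F 0 = 0" "jacobian_matrix F 0 = mat 1"
  shows "\<exists>L. vars_below n L \<and> degrees_in {2..} L \<and> nonsingular L
    \<and> (\<forall>x. perturbed_id L (emb x) = emb (F x))"
proof -
  obtain L0 where L0: "vars_below n L0" and F_terms: "\<And>x j. F x $ j = terms_eval L0 (emb x) (ix j)"
    using poly_map_as_terms[of F] normalised(1) by (auto simp: keller_map_def)
  define L where "L = terms_of_degree {2..} L0"
  have below: "vars_below n L" unfolding L_def by (rule vars_below_terms_of_degree[OF L0])
  have emb_0: "emb 0 = (\<lambda>_. 0)" by (simp add: emb_def fun_eq_iff)
  have constant_part: "terms_eval L0 (\<lambda>_. 0) (ix j) = 0" for j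
    using F_terms[of 0 j] by (simp add: normalised(2) emb_0)
  have linear_part: "terms_deriv L0 (\<lambda>_. 0) (emb h) (ix j) = h $ j" for h j
    using jacobian_matrix_mult[OF F_terms, of 0 h j] by (simp add: normalised(3) emb_0)
  have "perturbed_id L (emb x) = emb (F x)" for x
  proof (rule emb_eqI)
    show "perturbed_id L (emb x) (ix j) = F x $ j" for j
      unfolding F_terms terms_eval_taylor[of L0 "emb x"] constant_part linear_part
      by (simp add: perturbed_id_def L_def)
    show "perturbed_id L (emb x) i = 0" if "n \<le> i" for i
      using that terms_sum_outside[OF below that] by (simp add: perturbed_id_def emb_def)
  qed
  moreover have "nonsingular L"
  proof (rule nonsingular_if_derivative_invertible[OF below])
    show "h $ j + terms_deriv L (emb x) (emb h) (ix j) = (jacobian_matrix F x *v h) $ j" for x h j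
      unfolding jacobian_matrix_mult[OF F_terms] terms_deriv_taylor[of L0 "emb x"] linear_part L_def ..
    show "invertible (jacobian_matrix F x)" for x
      using normalised(1) by (auto simp: keller_map_def invertible_det_nz)
  qed
  ultimately show ?thesis using below degrees_in_terms_of_degree unfolding L_def by blast
qed

lemma poly_automorphism_if_poly_invertible:
  assumes poly: "poly_map F" and below: "vars_below n L" and inv: "poly_invertible L"
    and F_eq: "\<And>x. perturbed_id L (emb x) = emb (F x)"
  shows "poly_automorphism F"
proof -
  obtain G where inverse: "\<And>i. poly_expr (\<lambda>x. G x i)" "\<And>x. G (perturbed_id L x) = x"
      "\<And>x. perturbed_id L (G x) = x"
    using inv unfolding poly_invertible_def by blast
  have "poly_fun (\<lambda>w. emb w i)" for i
    by (cases "i < n") (simp_all add: emb_def poly_fun_const poly_fun_var)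
  then have "poly_map (\<lambda>w. proj (G (emb w)))"
    unfolding poly_map_def proj_nth by (intro allI poly_fun_poly_expr[OF inverse(1)])
  moreover have "proj (G (emb (F x))) = x" for x by (simp add: F_eq[symmetric] inverse(2))
  moreover have "F (proj (G (emb w))) = w" for w
  proof -
    have "G (emb w) i = 0" if "n \<le> i" for i
      using fun_cong[OF inverse(3)[of "emb w"], of i] terms_sum_outside[OF below that] that
      by (simp add: perturbed_id_def emb_def)
    then have "emb (F (proj (G (emb w)))) = emb w"
      unfolding F_eq[symmetric] by (simp add: emb_proj inverse(3))
    then show ?thesis by (metis proj_emb)
  qed
  ultimately show ?thesis
    using poly unfolding poly_automorphism_def
    by (intro conjI exI[of _ "\<lambda>w. proj (G (emb w))"]) (auto simp: fun_eq_iff)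
qed

end

lemma keller_map_imp_automorphism_if_poly_invertible:
  fixes F :: "complex ^ 'n \<Rightarrow> complex ^ 'n"
  assumes invertible: "\<And>N (L :: complex monomial_term list).
      vars_below N L \<Longrightarrow> degrees_in {2..} L \<Longrightarrow> nonsingular L \<Longrightarrow> poly_invertible L"
    and "keller_map F"
  shows "poly_automorphism F"
proof (rule keller_map_imp_automorphism_if_normalised[OF _ \<open>keller_map F\<close>])
  fix F :: "complex ^ 'n \<Rightarrow> complex ^ 'n"
  assume normalised: "keller_map F" "F 0 = 0" "jacobian_matrix F 0 = mat 1"
  obtain e :: "nat \<Rightarrow> 'n" where "bij_betw e {..<CARD('n)} UNIV"
    using ex_bij_betw_nat_finite[of "UNIV :: 'n set"] by (auto simp: atLeast0LessThan)
  then interpret coordinates e "CARD('n)" by unfold_locales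
  obtain L where perturbation: "vars_below CARD('n) L" "degrees_in {2..} L" "nonsingular L"
    and F_eq: "\<And>x. perturbed_id L (emb x) = emb (F x)"
    using normalised_keller_map_as_perturbed_id[OF normalised] by blast
  have "poly_map F" using normalised(1) by (simp add: keller_map_def)
  then show "poly_automorphism F"
    using perturbation(1) invertible[OF perturbation] F_eq by (rule poly_automorphism_if_poly_invertible)
qed

theorem theorem1p6:
  assumes "\<exists>d::nat. 3 \<le> d \<and>
             (\<forall>p::nat. 1 \<le> p \<longrightarrow>
                (\<exists>k0. \<forall>k \<ge> k0. \<exists>P. is_shuffle_family d p k P \<and> uniform_stationary d p k P))"
  shows "\<forall>F :: complex ^ 'n \<Rightarrow> complex ^ 'n. keller_map F \<longrightarrow> poly_automorphism F"
proof (intro allI impI)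
  fix F :: "complex ^ 'n \<Rightarrow> complex ^ 'n"
  assume keller: "keller_map F"
  obtain d where d: "3 \<le> d" and chains: "uniform_shuffle_chains d"
    using assms unfolding uniform_shuffle_chains_def by blast
  have homogeneous: "poly_invertible L"
    if "vars_below N L" "degrees_in {d} L" "nonsingular L" for N and L :: "complex monomial_term list"
  proof -
    interpret homogeneous_perturbation d N L using that d by unfold_locales simp_all
    show ?thesis using chains by (rule poly_invertible_if_uniform_shuffle_chains)
  qed
  have "poly_invertible L"
    if "vars_below N L" "degrees_in {2..} L" "nonsingular L" for N and L :: "complex monomial_term list"
    using d homogeneous that by (rule reduce_to_homogeneous)
  then show "poly_automorphism F"
    using keller by (rule keller_map_imp_automorphism_if_poly_invertible)
qed

end
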